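(* Let $n \geq 3$, let $K \subseteq \mathbb{R}^n$ be a convex body, and let $p_0$ be the point of maximal depth of $K$. Then there are at least four distinct hyperplanes $h$ (passing through $p_0$) such that $p_0$ is the barycenter of $K \cap h$.
   Context: A convex body in $\mathbb{R}^n$ is a compact convex set with nonempty interior. Let $\lambda$ be the Lebesgue measure on $\mathbb{R}^n$. For a point $p$ in the interior of $K$ and a unit vector $v \in S^{n-1} \subseteq \mathbb{R}^n$, let $H_v^p = \{x \in \mathbb{R}^n : \langle v, x-p\rangle \geq 0\}$, and define $\delta^p(v) = \lambda(H_v^p \cap K)/\lambda(K)$. The depth of $p$ in $K$ is $\mathrm{depth}(p,K) = \inf_{v \in S^{n-1}} \delta^p(v)$. The point of maximal depth of $K$ is the point $p_0$ in the interior of $K$ at which $\mathrm{depth}(p,K)$ attains its maximum over all interior points $p$ of $K$; it exists and is unique. For a hyperplane $h$ and a bounded measurable set $Y \subseteq h$ of positive $(n-1)$-dimensional Lebesgue measure $\lambda_{n-1}(Y)$, the barycenter (centroid) of $Y$ is the point $\frac{1}{\lambda_{n-1}(Y)}\int_Y x \, d\lambda_{n-1}(x)$. *)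

theory Defs
  imports "HOL-Analysis.Analysis"
begin

definition convex_body :: "(real^'n) set \<Rightarrow> bool" where
  "convex_body K \<longleftrightarrow> convex K \<and> compact K \<and> interior K \<noteq> {}"

definition halfspace_at :: "real^'n \<Rightarrow> real^'n \<Rightarrow> (real^'n) set" where
  "halfspace_at p v = {x. v \<bullet> (x - p) \<ge> 0}"

definition cut_fraction :: "(real^'n) set \<Rightarrow> real^'n \<Rightarrow> real^'n \<Rightarrow> real" where
  "cut_fraction K p v = measure lebesgue (halfspace_at p v \<inter> K) / measure lebesgue K"

definition depth :: "real^'n \<Rightarrow> (real^'n) set \<Rightarrow> real" where
  "depth p K = (INF v\<in>sphere 0 1. cut_fraction K p v)"

definition is_point_of_maximal_depth :: "(real^'n) set \<Rightarrow> real^'n \<Rightarrow> bool" where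
  "is_point_of_maximal_depth K p0 \<longleftrightarrow>
     p0 \<in> interior K \<and> (\<forall>p\<in>interior K. depth p K \<le> depth p0 K)"

definition is_hyperplane :: "(real^'n) set \<Rightarrow> bool" where
  "is_hyperplane h \<longleftrightarrow> (\<exists>a b. a \<noteq> 0 \<and> h = {x. a \<bullet> x = b})"

definition orthonormal_frame :: "(real^'n) set \<Rightarrow> real^'n \<Rightarrow> (real^'n) set \<Rightarrow> bool" where
  "orthonormal_frame h a B \<longleftrightarrow>
     a \<in> h \<and> finite B \<and> pairwise orthogonal B \<and> (\<forall>b\<in>B. norm b = 1) \<and>
     span B = (\<lambda>x. x - a) ` h"

text \<open>
  The Lebesgue measure of a hyperplane (or any nonempty affine subspace) \<open>h\<close> is the
  Lebesgue measure transported by orthonormal Cartesian coordinates on \<open>h\<close>, exactly as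
  \<open>lborel_eq\<close> describes \<open>lborel\<close> in terms of the standard basis. By rotation and
  translation invariance, the measure does not depend on the frame that is chosen. It is a
  measure on the ambient space that is concentrated on \<open>h\<close>.
\<close>

definition frame_lborel :: "real^'n \<Rightarrow> (real^'n) set \<Rightarrow> (real^'n) measure" where
  "frame_lborel a B =
     distr (\<Pi>\<^sub>M b\<in>B. lborel) borel (\<lambda>f. a + (\<Sum>b\<in>B. f b *\<^sub>R b))"

definition lebesgue_of :: "(real^'n) set \<Rightarrow> (real^'n) measure" where
  "lebesgue_of h =
     completion (SOME M. \<exists>a B. orthonormal_frame h a B \<and> M = frame_lborel a B)"

definition is_barycenter :: "real^'n \<Rightarrow> (real^'n) set \<Rightarrow> (real^'n) set \<Rightarrow> bool" where
  "is_barycenter p h Y \<longleftrightarrow>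
     Y \<subseteq> h \<and> bounded Y \<and> Y \<in> sets (lebesgue_of h) \<and> measure (lebesgue_of h) Y > 0 \<and>
     p = (1 / measure (lebesgue_of h) Y) *\<^sub>R (LINT x:Y|lebesgue_of h. x)"

lemma orthonormal_frame_exists:
  assumes "is_hyperplane h"
  shows "\<exists>a B. orthonormal_frame h a B"
proof -
  obtain c d where c: "c \<noteq> 0" and h: "h = {x. c \<bullet> x = d}"
    using assms by (auto simp: is_hyperplane_def)
  define a where "a = (d / (c \<bullet> c)) *\<^sub>R c"
  have a: "a \<in> h"
    using c by (simp add: h a_def)
  have "affine h"
    by (simp add: h affine_hyperplane)
  then have "subspace ((\<lambda>x. x - a) ` h)"
    using a by (rule affine_diffs_subspace_subtract)
  then obtain B where B: "pairwise orthogonal B" "\<And>b. b \<in> B \<Longrightarrow> norm b = 1"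
      "independent B" "span B = (\<lambda>x. x - a) ` h"
    using orthonormal_basis_subspace[of "(\<lambda>x. x - a) ` h"] by metis
  have "finite B"
    using B(3) by (rule independent_imp_finite)
  with a B have "orthonormal_frame h a B"
    unfolding orthonormal_frame_def by simp
  then show ?thesis
    by blast
qed

lemma lebesgue_of_frame:
  assumes "is_hyperplane h"
  obtains a B where "orthonormal_frame h a B" "lebesgue_of h = completion (frame_lborel a B)"
proof -
  have "\<exists>M a B. orthonormal_frame h a B \<and> M = frame_lborel a B"
    using orthonormal_frame_exists[OF assms] by blast
  then obtain a B where "orthonormal_frame h a B"
      "(SOME M. \<exists>a B. orthonormal_frame h a B \<and> M = frame_lborel a B) = frame_lborel a B"
    using someI_ex[where P = "\<lambda>M. \<exists>a B. orthonormal_frame h a B \<and> M = frame_lborel a B"]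
    by auto
  then show ?thesis
    by (intro that[of a B]) (simp_all add: lebesgue_of_def)
qed

end

theory Submission
  imports Defs
begin

text \<open>
  For a direction \<open>z \<noteq> 0\<close> let \<open>F z\<close> be the volume of the part of \<open>K\<close> on the side \<open>z\<close> of the hyperplane
  through \<open>p0\<close> with normal \<open>z\<close> (\<open>cut_volume\<close>). Tilting the hyperplane in the direction \<open>h\<close>
  adds and removes thin wedges whose thickness at a point \<open>x\<close> of the hyperplane is proportional to
  \<open>h \<bullet> (x - p0)\<close>. Hence \<open>F\<close> is continuously differentiable away from \<open>0\<close>, and its gradient at a unit
  vector \<open>v\<close> is the first moment of the section about \<open>p0\<close>: where the gradient vanishes, \<open>p0\<close> is the
  barycenter of the section with normal \<open>v\<close> (\<open>cut_volume_C1\<close>). The task is to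
  find four critical points of \<open>F\<close> on the unit sphere, no two of them equal up to sign.

  Let \<open>M\<close> be the set of unit vectors at which \<open>F\<close> attains its minimum. If \<open>0\<close> were not in the convex
  hull of \<open>M\<close>, some \<open>u\<close> would satisfy \<open>u \<bullet> v > 0\<close> for all \<open>v \<in> M\<close>, and moving \<open>p0\<close> slightly in the
  direction \<open>- u\<close> would enlarge all the smallest cuts at once and so increase the depth
  (\<open>zero_in_hull_of_minimal_directions\<close>). As \<open>F (- z) = \<lambda>(K) - F z\<close>, a pair of antipodal points
  in \<open>M\<close> forces \<open>F\<close> to be constant, and then all directions are critical. Otherwise \<open>M\<close> has at
  least three points, since \<open>0\<close> is in its convex hull; if it has four or more, they are the
  directions sought.

  There remains the case of exactly three minima, where \<open>n \<ge> 3\<close> is essential. The three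
  minima lie in a plane, together with their antipodes, where \<open>F\<close> is maximal. Two of them can be
  joined by a path that leaves this plane and so avoids all maxima, while near its isolated minima
  \<open>F\<close> is strictly larger than its minimum. By the mountain pass principle (\<open>mountain_pass\<close>) there is
  a critical point with a value strictly between the minimum and the maximum: it is neither one of
  the three minima nor one of their antipodes (\<open>four_critical_lines\<close>).
\<close>

section \<open>Coordinates in an orthonormal basis\<close>

lemma nn_integral_lborel_translate:
  fixes f :: "'a::euclidean_space \<Rightarrow> ennreal"
  assumes [measurable]: "f \<in> borel_measurable borel"
  shows "(\<integral>\<^sup>+x. f (t + x) \<partial>lborel) = (\<integral>\<^sup>+x. f x \<partial>lborel)"
proof -
  have "(\<integral>\<^sup>+x. f x \<partial>lborel) = (\<integral>\<^sup>+x. f x \<partial>distr lborel borel ((+) t))"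
    by (simp add: lborel_distr_plus)
  then show ?thesis by (simp add: nn_integral_distr)
qed

lemma nn_integral_lborel_reflect:
  fixes f :: "'a::euclidean_space \<Rightarrow> ennreal"
  assumes [measurable]: "f \<in> borel_measurable borel"
  shows "(\<integral>\<^sup>+x. f (t - x) \<partial>lborel) = (\<integral>\<^sup>+x. f x \<partial>lborel)"
proof -
  have "lborel = distr lborel borel (\<lambda>x::'a. t + (-1) *\<^sub>R x)"
    using lborel_affine[of "-1" t] by (simp add: density_1)
  then have "(\<integral>\<^sup>+x. f x \<partial>lborel) = (\<integral>\<^sup>+x. f x \<partial>distr lborel borel (\<lambda>x::'a. t + (-1) *\<^sub>R x))"
    by simp
  also have "\<dots> = (\<integral>\<^sup>+x. f (t - x) \<partial>lborel)" by (subst nn_integral_distr) simp_all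
  finally show ?thesis by simp
qed

text \<open>
  This is the argument for the uniqueness of Haar measure. For every Borel set \<open>A\<close> and the unit ball
  \<open>B\<close>, Tonelli's theorem and translation invariance give
  \<open>\<lambda>(T\<^sup>-\<^sup>1 A) \<lambda>(B) = \<lambda>(A) \<lambda>(T\<^sup>-\<^sup>1 B)\<close>, and \<open>T\<^sup>-\<^sup>1 B = B\<close> has positive finite measure.
\<close>

lemma distr_lborel_orthogonal:
  fixes T :: "'a::euclidean_space \<Rightarrow> 'a"
  assumes T: "orthogonal_transformation T"
  shows "distr lborel borel T = lborel"
proof (rule measure_eqI)
  have lin: "linear T" using T by (rule orthogonal_transformation_linear)
  then have [measurable]: "T \<in> borel_measurable borel"
    by (simp add: borel_measurable_continuous_onI linear_continuous_on linear_conv_bounded_linear)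
  have bij: "bij T" using T by (rule orthogonal_transformation_bij)
  have inv: "orthogonal_transformation (inv T)" using T by (rule orthogonal_transformation_inv)
  then have Tinv: "T (- inv T y + x) = T x - y" for x y
    using lin bij by (simp add: linear_add linear_diff linear_neg bij_is_surj surj_f_inv_f)
  define B :: "'a set" where "B = ball 0 1"
  have BB: "T x \<in> B \<longleftrightarrow> x \<in> B" for x
    using T by (simp add: B_def orthogonal_transformation_norm)
  have [measurable]: "B \<in> sets borel" by (simp add: B_def)
  fix A assume "A \<in> sets (distr lborel borel T)"
  then have A[measurable]: "A \<in> sets borel" by simp
  have "(\<integral>\<^sup>+x. indicator A (T x) \<partial>lborel) * emeasure lborel B
      = (\<integral>\<^sup>+x. indicator A (T x) * (\<integral>\<^sup>+y. indicator B (T x + y) \<partial>lborel) \<partial>lborel)"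
    by (simp add: nn_integral_lborel_translate[of "indicator B"] nn_integral_multc)
  also have "\<dots> = (\<integral>\<^sup>+x. \<integral>\<^sup>+y. indicator A (T x) * indicator B (T x + y) \<partial>lborel \<partial>lborel)"
    by (simp add: nn_integral_cmult)
  also have "\<dots> = (\<integral>\<^sup>+y. \<integral>\<^sup>+x. indicator A (T x) * indicator B (T x + y) \<partial>lborel \<partial>lborel)"
    by (rule lborel_pair.Fubini') simp
  also have "\<dots> = (\<integral>\<^sup>+y. \<integral>\<^sup>+x. indicator A (T x - y) * indicator B (T x) \<partial>lborel \<partial>lborel)"
  proof (rule nn_integral_cong)
    fix y :: 'a
    have "(\<integral>\<^sup>+x. indicator A (T (- inv T y + x)) * indicator B (T (- inv T y + x) + y) \<partial>lborel)
      = (\<integral>\<^sup>+x. indicator A (T x) * indicator B (T x + y) \<partial>(lborel :: 'a measure) :: ennreal)"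
      by (rule nn_integral_lborel_translate) simp
    then show "(\<integral>\<^sup>+x. indicator A (T x) * indicator B (T x + y) \<partial>lborel)
      = (\<integral>\<^sup>+x. indicator A (T x - y) * indicator B (T x) \<partial>lborel :: ennreal)"
      unfolding Tinv by simp
  qed
  also have "\<dots> = (\<integral>\<^sup>+x. \<integral>\<^sup>+y. indicator A (T x - y) * indicator B (T x) \<partial>lborel \<partial>lborel)"
    by (rule lborel_pair.Fubini') simp
  also have "\<dots> = (\<integral>\<^sup>+x. (\<integral>\<^sup>+y. indicator A (T x - y) \<partial>lborel) * indicator B x \<partial>lborel)"
    by (simp add: nn_integral_multc indicator_def BB)
  also have "\<dots> = emeasure lborel A * emeasure lborel B"
    by (simp add: nn_integral_lborel_reflect[of "indicator A"] nn_integral_cmult)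
  finally have eq: "(\<integral>\<^sup>+x. indicator A (T x) \<partial>lborel) * emeasure lborel B
      = emeasure lborel A * emeasure lborel B" .
  have "0 < emeasure lborel B" "emeasure lborel B < \<infinity>"
    using content_ball_pos[of 1 "0::'a"] emeasure_lborel_ball_finite[of "0::'a" 1]
    by (auto simp: B_def measure_def enn2real_positive_iff)
  with eq have "(\<integral>\<^sup>+x. indicator A (T x) \<partial>lborel) = emeasure lborel A"
    by (auto simp: mult.commute[of _ "emeasure lborel B"] ennreal_mult_cancel_left)
  moreover have "emeasure (distr lborel borel T) A = (\<integral>\<^sup>+x. indicator A x \<partial>distr lborel borel T)"
    by simp
  ultimately show "emeasure (distr lborel borel T) A = emeasure lborel A"
    by (simp add: nn_integral_distr del: nn_integral_indicator)
qed simp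

text \<open>
  A bijection from the standard basis to \<open>C\<close> extends to an orthogonal transformation. The claim follows
  from the invariance of the measure under it, after reindexing the product measure.
\<close>

lemma orthonormal_coordinates_lborel:
  fixes C :: "(real^'n) set"
  assumes fin: "finite C" and card: "card C = CARD('n)"
    and orth: "pairwise orthogonal C" and norm: "\<And>c. c \<in> C \<Longrightarrow> norm c = 1"
  shows "distr (\<Pi>\<^sub>M c\<in>C. lborel) borel (\<lambda>f. \<Sum>c\<in>C. f c *\<^sub>R c) = (lborel :: (real^'n) measure)"
proof -
  have "card (Basis :: (real^'n) set) = card C" using card by simp
  then obtain \<phi> where \<phi>: "bij_betw \<phi> (Basis :: (real^'n) set) C"
    using fin by (metis finite_Basis finite_same_card_bij)
  have inj: "inj_on \<phi> Basis" and img: "\<phi> ` Basis = C"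
    using \<phi> by (auto simp: bij_betw_def)
  have \<phi>\<phi>: "\<phi> b \<bullet> \<phi> b' = (if b = b' then 1 else 0)" if "b \<in> Basis" "b' \<in> Basis" for b b'
  proof (cases "b = b'")
    case True
    then show ?thesis using norm[of "\<phi> b"] img that by (auto simp: dot_square_norm)
  next
    case False
    then have "\<phi> b \<noteq> \<phi> b'" using inj that by (auto dest: inj_onD)
    moreover have "\<phi> b \<in> C" "\<phi> b' \<in> C" using img that by auto
    ultimately show ?thesis using orth False by (auto simp: pairwise_def orthogonal_def)
  qed
  define T where "T x = (\<Sum>b\<in>Basis. (x \<bullet> b) *\<^sub>R \<phi> b)" for x :: "real^'n"
  have "linear T" unfolding T_def
    by (intro linearI) (simp_all add: inner_add_left scaleR_add_left sum.distrib scaleR_sum_right)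
  moreover have "T x \<bullet> T y = x \<bullet> y" for x y
  proof -
    have "T x \<bullet> T y = (\<Sum>b\<in>Basis. \<Sum>b'\<in>Basis. (x \<bullet> b) * ((y \<bullet> b') * (\<phi> b \<bullet> \<phi> b')))"
      unfolding T_def by (subst inner_sum_left, subst inner_sum_right) (simp add: mult_ac)
    also have "\<dots> = (\<Sum>b\<in>Basis. \<Sum>b'\<in>Basis. if b = b' then (x \<bullet> b) * (y \<bullet> b') else 0)"
      by (intro sum.cong) (auto simp: \<phi>\<phi>)
    also have "\<dots> = x \<bullet> y" by (simp add: euclidean_inner[of x y])
    finally show ?thesis .
  qed
  ultimately have T: "orthogonal_transformation T"
    by (simp add: orthogonal_transformation_def)
  then have lin: "linear T" by (rule orthogonal_transformation_linear)
  then have [measurable]: "T \<in> borel_measurable borel"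
    by (simp add: borel_measurable_continuous_onI linear_continuous_on linear_conv_bounded_linear)
  have Tb: "T b = \<phi> b" if "b \<in> Basis" for b
  proof -
    have "T b = (\<Sum>b'\<in>Basis. if b = b' then \<phi> b' else 0)"
      unfolding T_def using that by (intro sum.cong) (auto simp: inner_Basis)
    then show ?thesis using that by simp
  qed
  let ?R = "\<lambda>g::real^'n \<Rightarrow> real. \<lambda>b\<in>Basis. g (\<phi> b)"
  have mR[measurable]: "?R \<in> (\<Pi>\<^sub>M c\<in>C. lborel) \<rightarrow>\<^sub>M (\<Pi>\<^sub>M b\<in>Basis. lborel)"
    using img by (intro measurable_restrict measurable_component_singleton) auto
  interpret P: product_sigma_finite "\<lambda>_::real^'n. lborel :: real measure" ..
  have reindex: "distr (\<Pi>\<^sub>M c\<in>C. lborel) (\<Pi>\<^sub>M b\<in>Basis. lborel) ?R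
      = (\<Pi>\<^sub>M b\<in>(Basis::(real^'n) set). lborel :: real measure)"
  proof (rule P.PiM_eqI)
    fix A :: "real^'n \<Rightarrow> real set" assume A: "\<And>i. i \<in> Basis \<Longrightarrow> A i \<in> sets lborel"
    define A' where "A' c = A (inv_into Basis \<phi> c)" for c
    have A'\<phi>: "A' (\<phi> b) = A b" if "b \<in> Basis" for b
      using inj that by (simp add: A'_def)
    have A'm: "A' c \<in> sets lborel" if "c \<in> C" for c
      using that img A A'\<phi> by (metis (no_types, lifting) imageE)
    have "?R -` (\<Pi>\<^sub>E i\<in>Basis. A i) \<inter> space (\<Pi>\<^sub>M c\<in>C. lborel) = (\<Pi>\<^sub>E c\<in>C. A' c)"
      using A'\<phi> by (auto simp: space_PiM PiE_iff img[symmetric] extensional_def)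
    then have "emeasure (distr (\<Pi>\<^sub>M c\<in>C. lborel) (\<Pi>\<^sub>M b\<in>Basis. lborel) ?R) (Pi\<^sub>E Basis A)
        = emeasure (\<Pi>\<^sub>M c\<in>C. lborel) (\<Pi>\<^sub>E c\<in>C. A' c)"
      using A by (subst emeasure_distr) (auto intro!: sets_PiM_I_finite)
    also have "\<dots> = (\<Prod>c\<in>C. emeasure lborel (A' c))"
      using fin A'm by (subst P.emeasure_PiM) auto
    also have "\<dots> = (\<Prod>b\<in>Basis. emeasure lborel (A' (\<phi> b)))"
      using prod.reindex_bij_betw[OF \<phi>, of "\<lambda>c. emeasure lborel (A' c)"] by simp
    finally show "emeasure (distr (\<Pi>\<^sub>M c\<in>C. lborel) (\<Pi>\<^sub>M b\<in>Basis. lborel) ?R) (Pi\<^sub>E Basis A)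
        = (\<Prod>i\<in>Basis. emeasure lborel (A i))"
      using A'\<phi> by simp
  qed auto
  have "lborel = distr (lborel :: (real^'n) measure) borel T"
    using distr_lborel_orthogonal[OF T] by simp
  also have "\<dots> = distr (distr (\<Pi>\<^sub>M b\<in>Basis. lborel) borel (\<lambda>f. \<Sum>b\<in>Basis. f b *\<^sub>R b)) borel T"
    by (subst lborel_eq) simp
  also have "\<dots> = distr (distr (\<Pi>\<^sub>M c\<in>C. lborel) (\<Pi>\<^sub>M b\<in>Basis. lborel) ?R) borel
      (T \<circ> (\<lambda>f. \<Sum>b\<in>Basis. f b *\<^sub>R b))"
    by (subst reindex) (simp add: distr_distr)
  also have "\<dots> = distr (\<Pi>\<^sub>M c\<in>C. lborel) borel ((T \<circ> (\<lambda>f. \<Sum>b\<in>Basis. f b *\<^sub>R b)) \<circ> ?R)"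
    by (rule distr_distr) auto
  also have "\<dots> = distr (\<Pi>\<^sub>M c\<in>C. lborel) borel (\<lambda>f. \<Sum>c\<in>C. f c *\<^sub>R c)"
  proof (rule distr_cong)
    fix f
    have "((T \<circ> (\<lambda>f. \<Sum>b\<in>Basis. f b *\<^sub>R b)) \<circ> ?R) f = (\<Sum>b\<in>Basis. f (\<phi> b) *\<^sub>R \<phi> b)"
      using lin by (simp add: linear_sum linear_scale Tb)
    also have "\<dots> = (\<Sum>c\<in>C. f c *\<^sub>R c)"
      using sum.reindex_bij_betw[OF \<phi>, of "\<lambda>c. f c *\<^sub>R c"] by simp
    finally show "((T \<circ> (\<lambda>f. \<Sum>b\<in>Basis. f b *\<^sub>R b)) \<circ> ?R) f = (\<Sum>c\<in>C. f c *\<^sub>R c)" .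
  qed auto
  finally show ?thesis by simp
qed


section \<open>Slicing space along the normal of a hyperplane\<close>

text \<open>
  Everything that is needed about the measure of a hyperplane follows from one formula of Fubini type,
  \<open>emeasure_slices\<close>: a set in space is measured by integrating the lengths of its fibers in the
  direction of the unit normal \<open>v\<close>.
\<close>

locale hyperplane_frame =
  fixes p v a :: "real^'n" and B :: "(real^'n) set"
  assumes v1: "norm v = 1" and frame: "orthonormal_frame {x. v \<bullet> (x - p) = 0} a B"
begin

abbreviation "N \<equiv> frame_lborel a B"

lemma vv: "v \<bullet> v = 1" using v1 by (simp add: dot_square_norm)

lemma finB: "finite B" and a_mem: "v \<bullet> (a - p) = 0"
  and orthB: "pairwise orthogonal B" and normB: "b \<in> B \<Longrightarrow> norm b = 1"
  using frame by (auto simp: orthonormal_frame_def)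

lemma spanB: "span B = {x. v \<bullet> x = 0}"
proof -
  have "span B = (\<lambda>x. x - a) ` {x. v \<bullet> (x - p) = 0}"
    using frame by (simp add: orthonormal_frame_def)
  also have "\<dots> = {x. v \<bullet> x = 0}"
  proof (intro equalityI subsetI)
    fix x assume "x \<in> {x. v \<bullet> x = 0}"
    then have "v \<bullet> (x + a - p) = 0" "x = (x + a) - a"
      using a_mem by (auto simp: inner_diff_right inner_add_right)
    then show "x \<in> (\<lambda>x. x - a) ` {x. v \<bullet> (x - p) = 0}" by blast
  qed (use a_mem in \<open>auto simp: inner_diff_right\<close>)
  finally show ?thesis .
qed

lemma v_orth: "b \<in> B \<Longrightarrow> v \<bullet> b = 0"
  using span_base[of b B] by (simp add: spanB)

lemma v_notin: "v \<notin> B" using v_orth vv by force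

lemma sets_N [simp, measurable_cong]: "sets N = sets borel"
  and space_N [simp]: "space N = UNIV"
  by (simp_all add: frame_lborel_def)

lemma embed_measurable [measurable]:
  "(\<lambda>f. a + (\<Sum>b\<in>B. f b *\<^sub>R b)) \<in> borel_measurable (\<Pi>\<^sub>M b\<in>B. lborel)"
  by measurable

lemma AE_mem: "AE y in N. v \<bullet> (y - p) = 0"
proof -
  have "v \<bullet> (a + (\<Sum>b\<in>B. f b *\<^sub>R b) - p) = 0" for f :: "real^'n \<Rightarrow> real"
    using a_mem v_orth by (simp add: inner_diff_right inner_add_right inner_sum_right)
  then show ?thesis
    unfolding frame_lborel_def by (subst AE_distr_iff) auto
qed

lemma card_insert: "card (insert v B) = CARD('n)"
proof -
  have "pairwise orthogonal (insert v B)"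
    using orthB v_orth by (auto simp: pairwise_insert orthogonal_def inner_commute)
  moreover have "0 \<notin> insert v B" using normB v1 by force
  ultimately have ind: "independent (insert v B)" by (rule pairwise_orthogonal_independent)
  have "x \<in> span (insert v B)" for x
  proof -
    have "v \<bullet> (x - (v \<bullet> x) *\<^sub>R v) = 0" by (simp add: inner_diff_right vv)
    then have "x - (v \<bullet> x) *\<^sub>R v \<in> span B" by (simp add: spanB)
    then show ?thesis using span_breakdown_eq by blast
  qed
  then have "span (insert v B) = UNIV" by auto
  then have "dim (insert v B) = CARD('n)"
    by (metis dim_UNIV dim_span DIM_cart DIM_real mult.right_neutral)
  then show ?thesis using ind by (simp add: dim_eq_card_independent)
qed

text \<open>
  The frame together with \<open>v\<close> is an orthonormal basis of the whole space, so the coordinate along \<open>v\<close>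
  can be split off.
\<close>

lemma emeasure_slices:
  assumes A[measurable]: "A \<in> sets borel"
  shows "emeasure lborel A = (\<integral>\<^sup>+y. emeasure lborel {s. y + s *\<^sub>R v \<in> A} \<partial>N)"
proof -
  interpret P: product_sigma_finite "\<lambda>_::real^'n. lborel :: real measure" ..
  let ?C = "insert v B"
  have coord: "distr (\<Pi>\<^sub>M c\<in>?C. lborel) borel (\<lambda>f. \<Sum>c\<in>?C. f c *\<^sub>R c) = (lborel :: (real^'n) measure)"
    using finB card_insert orthB v_orth normB v1
    by (intro orthonormal_coordinates_lborel)
       (auto simp: pairwise_insert orthogonal_def inner_commute)
  have "emeasure lborel A = (\<integral>\<^sup>+x. indicator A x \<partial>lborel)" by simp
  also have "\<dots> = (\<integral>\<^sup>+x. indicator A (a + x) \<partial>lborel)"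
    by (subst nn_integral_lborel_translate) auto
  also have "\<dots> = (\<integral>\<^sup>+f. indicator A (a + (\<Sum>c\<in>?C. f c *\<^sub>R c)) \<partial>(\<Pi>\<^sub>M c\<in>?C. lborel))"
    by (subst coord[symmetric], subst nn_integral_distr) auto
  also have "\<dots> = (\<integral>\<^sup>+f. \<integral>\<^sup>+s. indicator A (a + (\<Sum>c\<in>?C. (f(v := s)) c *\<^sub>R c)) \<partial>lborel \<partial>(\<Pi>\<^sub>M c\<in>B. lborel))"
    using finB v_notin by (subst P.product_nn_integral_insert) auto
  also have "\<dots> = (\<integral>\<^sup>+f. \<integral>\<^sup>+s. indicator A (a + (\<Sum>c\<in>B. f c *\<^sub>R c) + s *\<^sub>R v) \<partial>lborel \<partial>(\<Pi>\<^sub>M c\<in>B. lborel))"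
  proof (intro nn_integral_cong)
    fix f :: "real^'n \<Rightarrow> real" and s :: real
    have "(\<Sum>c\<in>?C. (f(v := s)) c *\<^sub>R c) = s *\<^sub>R v + (\<Sum>c\<in>B. (f(v := s)) c *\<^sub>R c)"
      using finB v_notin by simp
    also have "(\<Sum>c\<in>B. (f(v := s)) c *\<^sub>R c) = (\<Sum>c\<in>B. f c *\<^sub>R c)"
      using v_notin by (intro sum.cong) auto
    finally show "(indicator A (a + (\<Sum>c\<in>?C. (f(v := s)) c *\<^sub>R c)) :: ennreal)
        = indicator A (a + (\<Sum>c\<in>B. f c *\<^sub>R c) + s *\<^sub>R v)"
      by (simp add: add_ac)
  qed
  also have "\<dots> = (\<integral>\<^sup>+y. \<integral>\<^sup>+s. indicator A (y + s *\<^sub>R v) \<partial>lborel \<partial>N)"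
    unfolding frame_lborel_def by (subst nn_integral_distr) auto
  also have "\<dots> = (\<integral>\<^sup>+y. emeasure lborel {s. y + s *\<^sub>R v \<in> A} \<partial>N)"
  proof (rule nn_integral_cong)
    fix y
    have "{s. y + s *\<^sub>R v \<in> A} \<in> sets lborel" by measurable
    then have "emeasure lborel {s. y + s *\<^sub>R v \<in> A}
        = (\<integral>\<^sup>+s. indicator {s. y + s *\<^sub>R v \<in> A} s \<partial>lborel)" by simp
    then show "(\<integral>\<^sup>+s. indicator A (y + s *\<^sub>R v) \<partial>lborel) = emeasure lborel {s. y + s *\<^sub>R v \<in> A}"
      by (simp add: indicator_def)
  qed
  finally show ?thesis .
qed

text \<open>
  The set \<open>A\<close> is the base of a cylinder of height \<open>1\<close>, which is bounded and has the same measure.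
\<close>

lemma emeasure_N_bounded:
  assumes A[measurable]: "A \<in> sets borel" and bdd: "bounded A"
  shows "emeasure N A < \<infinity>"
proof -
  define X where "X = {x. x - (v \<bullet> (x - p)) *\<^sub>R v \<in> A \<and> 0 \<le> v \<bullet> (x - p) \<and> v \<bullet> (x - p) \<le> 1}"
  have X[measurable]: "X \<in> sets borel" unfolding X_def by measurable
  obtain R where R: "\<And>x. x \<in> A \<Longrightarrow> norm x \<le> R" using bdd by (auto simp: bounded_iff)
  have "norm x \<le> R + 1" if "x \<in> X" for x
  proof -
    have "norm x \<le> norm (x - (v \<bullet> (x - p)) *\<^sub>R v) + norm ((v \<bullet> (x - p)) *\<^sub>R v)"
      by (metis add.commute diff_add_cancel norm_triangle_ineq)
    also have "\<dots> \<le> R + 1" using that by (intro add_mono R) (auto simp: X_def v1)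
    finally show ?thesis .
  qed
  then have "bounded X" by (auto simp: bounded_iff)
  then have fin: "emeasure lborel X < \<infinity>" by (rule emeasure_bounded_finite)
  have "emeasure N A = (\<integral>\<^sup>+y. indicator A y \<partial>N)" by simp
  also have "\<dots> = (\<integral>\<^sup>+y. emeasure lborel {s. y + s *\<^sub>R v \<in> X} \<partial>N)"
  proof (rule nn_integral_cong_AE, use AE_mem in eventually_elim)
    fix y assume y: "v \<bullet> (y - p) = 0"
    have "v \<bullet> (y + s *\<^sub>R v - p) = s" for s
      using y vv by (simp add: inner_diff_right inner_add_right)
    then have "{s. y + s *\<^sub>R v \<in> X} = (if y \<in> A then {0..1} else {})" by (auto simp: X_def)
    then show "indicator A y = emeasure lborel {s. y + s *\<^sub>R v \<in> X}" by simp
  qed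
  also have "\<dots> = emeasure lborel X" by (simp add: emeasure_slices)
  finally show ?thesis using fin by simp
qed

text \<open>
  This transfers null sets from the whole space to the hyperplane: a point of \<open>D\<close> contributes a fiber
  of infinite length.
\<close>

lemma AE_not_in_null_cylinder:
  assumes D[measurable]: "D \<in> sets borel" and null: "emeasure lborel D = 0"
    and cyl: "\<And>y s. y \<in> D \<Longrightarrow> y + s *\<^sub>R v \<in> D"
  shows "AE y in N. y \<notin> D"
proof -
  have "0 = (\<integral>\<^sup>+y. emeasure lborel {s. y + s *\<^sub>R v \<in> D} \<partial>N)"
    using emeasure_slices[OF D] null by simp
  also have "\<dots> = (\<integral>\<^sup>+y. \<infinity> * indicator D y \<partial>N)"
  proof (rule nn_integral_cong)
    fix y
    have "{s. y + s *\<^sub>R v \<in> D} = (if y \<in> D then UNIV else {})"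
      using cyl[of "y + s *\<^sub>R v" "- s" for s] cyl[of y] by auto
    then show "emeasure lborel {s. y + s *\<^sub>R v \<in> D} = \<infinity> * indicator D y" by (simp add: indicator_def)
  qed
  also have "\<dots> = \<infinity> * emeasure N D" by (subst nn_integral_cmult_indicator) auto
  finally have "emeasure N D = 0" by (metis ennreal_top_mult infinity_ennreal_def zero_neq_one ennreal_top_neq_zero)
  then have "D \<in> null_sets N" by (auto simp: null_sets_def)
  then show ?thesis by (rule AE_not_in)
qed

end

section \<open>Lengths of slices\<close>

lemma measure_ray_diff:
  fixes I :: "real set"
  assumes I: "compact I" and tt: "t \<le> t'"
  shows "measure lborel (I \<inter> {t..}) - measure lborel (I \<inter> {t'..}) = measure lborel (I \<inter> {t..<t'})"
proof -
  have Ib[measurable]: "I \<in> sets borel" using I by (simp add: borel_compact)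
  have fin: "I \<inter> X \<in> fmeasurable lborel" if "X \<in> sets borel" for X
  proof (rule fmeasurableI)
    have "bounded (I \<inter> X)" using I by (meson bounded_Int compact_imp_bounded)
    then show "emeasure lborel (I \<inter> X) < \<infinity>" by (rule emeasure_bounded_finite)
  qed (use Ib that in auto)
  have "I \<inter> {t..} = (I \<inter> {t..<t'}) \<union> (I \<inter> {t'..})" using tt by auto
  moreover have "measure lborel ((I \<inter> {t..<t'}) \<union> (I \<inter> {t'..}))
      = measure lborel (I \<inter> {t..<t'}) + measure lborel (I \<inter> {t'..})"
    by (rule measure_Un_AE) (auto intro!: fin)
  ultimately show ?thesis by simp
qed

lemma measure_ray_lipschitz:
  fixes I :: "real set"
  assumes I: "compact I"
  shows "\<bar>measure lborel (I \<inter> {t..}) - measure lborel (I \<inter> {t'..})\<bar> \<le> \<bar>t - t'\<bar>"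
proof -
  have *: "\<bar>measure lborel (I \<inter> {t..}) - measure lborel (I \<inter> {t'..})\<bar> \<le> \<bar>t - t'\<bar>" if "t \<le> t'" for t t'
  proof -
    have "measure lborel (I \<inter> {t..<t'}) \<le> measure lborel {t..<t'}"
    proof (rule measure_mono_fmeasurable)
      show "{t..<t'} \<in> fmeasurable lborel"
        by (intro fmeasurableI emeasure_bounded_finite) auto
    qed (use I in \<open>auto simp: borel_compact\<close>)
    then show ?thesis using measure_ray_diff[OF I that] that by simp
  qed
  show ?thesis using *[of t t'] *[of t' t] by (cases "t \<le> t'") (auto simp: abs_minus_commute)
qed

text \<open>
  Around a point in the interior of \<open>I\<close>, or outside \<open>I\<close>, the length of the part of \<open>I\<close> above \<open>t\<close> is an
  affine function of \<open>t\<close>.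
\<close>

lemma measure_ray_derivative:
  fixes I :: "real set"
  assumes I: "compact I" and t: "t \<in> interior I \<or> t \<notin> I"
  shows "((\<lambda>t. measure lborel (I \<inter> {t..})) has_real_derivative - indicator I t) (at t)"
proof -
  let ?m = "\<lambda>t. measure lborel (I \<inter> {t..})"
  obtain e where e: "e > 0" and const: "ball t e \<subseteq> I \<or> ball t e \<inter> I = {}"
  proof (cases "t \<in> I")
    case True
    then show ?thesis using that t by (metis mem_interior)
  next
    case False
    then have "t \<in> - I" "open (- I)" using I by (auto simp: compact_imp_closed open_Compl)
    then show ?thesis using that by (metis open_contains_ball disjoint_eq_subset_Compl inf_commute)
  qed
  have lin: "?m t - indicator I t * (x - t) = ?m x" if x: "x \<in> ball t e" for x
  proof -
    have ind: "indicator I s = (indicator I t :: real)" if "s \<in> ball t e" for s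
    proof -
      have "t \<in> ball t e" using e by simp
      then have "s \<in> I \<longleftrightarrow> t \<in> I" using const that by blast
      then show ?thesis by (simp add: indicator_def)
    qed
    have slab: "measure lborel (I \<inter> {a..<b}) = indicator I t * (b - a)"
      if ab: "a \<le> b" "a \<in> ball t e" "b \<in> ball t e" for a b
    proof -
      have "{a..<b} \<subseteq> ball t e" using ab by (auto simp: dist_real_def)
      then have "I \<inter> {a..<b} = (if t \<in> I then {a..<b} else {})"
      proof -
        have "t \<in> ball t e" using e by simp
        then have "{a..<b} \<subseteq> I \<and> t \<in> I \<or> I \<inter> {a..<b} = {} \<and> t \<notin> I"
          using \<open>{a..<b} \<subseteq> ball t e\<close> const by blast
        then show ?thesis by (auto simp: inf_absorb2)
      qed
      then show ?thesis using ab by simp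
    qed
    show ?thesis
    proof (cases "t \<le> x")
      case True
      then show ?thesis using measure_ray_diff[OF I True] slab[of t x] e x by simp
    next
      case False
      then show ?thesis using measure_ray_diff[OF I, of x t] slab[of x t] e x
        by (simp add: algebra_simps)
    qed
  qed
  have "((\<lambda>x. ?m t - indicator I t * (x - t)) has_real_derivative - indicator I t) (at t)"
    by (auto intro!: derivative_eq_intros)
  then show ?thesis
    by (rule has_field_derivative_transform_within_open[where S = "ball t e"]) (use e lin in auto)
qed

section \<open>The gradient of the cut volume\<close>

definition cut_volume :: "(real^'n) set \<Rightarrow> real^'n \<Rightarrow> real^'n \<Rightarrow> real" where
  "cut_volume K p z = measure lborel {x \<in> K. 0 \<le> z \<bullet> (x - p)}"

text \<open>
  The chart of directions centered at \<open>v\<close>: all \<open>z\<close> with \<open>z \<bullet> v > 0\<close>. The hyperplane through \<open>p\<close> with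
  normal \<open>z\<close> is then the graph of the function \<open>height z\<close> over the fixed hyperplane with normal \<open>v\<close>, so
  that integrals over all these sections live on a single measure space. The projection along \<open>v\<close> onto
  the tilted hyperplane is \<open>proj z\<close>, and \<open>moment z\<close> will turn out to be the gradient of the cut volume.
\<close>

locale body_frame = hyperplane_frame p v a B for p v a :: "real^'n" and B +
  fixes K :: "(real^'n) set"
  assumes convexK: "convex K" and compactK: "compact K" and pK: "p \<in> interior K"
begin

definition height where "height z y = - (z \<bullet> (y - p)) / (z \<bullet> v)"

definition proj where "proj z y = y + height z y *\<^sub>R v"

definition upper where "upper z y = measure lborel {s. y + s *\<^sub>R v \<in> K \<and> height z y \<le> s}"

definition moment where
  "moment z = (1 / (z \<bullet> v)) *\<^sub>R (\<integral>y. indicator K (proj z y) *\<^sub>R (proj z y - p) \<partial>N)"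

lemma K_borel [measurable]: "K \<in> sets borel"
  using compactK by (simp add: borel_compact)

lemma height_measurable [measurable]: "height z \<in> borel_measurable borel"
  unfolding height_def by measurable

lemma proj_measurable [measurable]: "proj z \<in> borel_measurable borel"
  unfolding proj_def by measurable

lemma fiber_compact: "compact {s. y + s *\<^sub>R v \<in> K}"
proof -
  have "closed ((\<lambda>s. y + s *\<^sub>R v) -` K)"
    using compactK by (intro closed_vimage continuous_intros) (auto simp: compact_imp_closed)
  moreover have "bounded ((\<lambda>s. y + s *\<^sub>R v) -` K)"
  proof -
    obtain R where R: "\<And>x. x \<in> K \<Longrightarrow> norm x \<le> R"
      using compact_imp_bounded[OF compactK] unfolding bounded_iff by blast
    have "norm s \<le> R + norm y" if "y + s *\<^sub>R v \<in> K" for s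
    proof -
      have "norm s = norm ((y + s *\<^sub>R v) - y)" by (simp add: v1)
      also have "\<dots> \<le> norm (y + s *\<^sub>R v) + norm y" by (rule norm_triangle_ineq4)
      finally show ?thesis using R[OF that] by simp
    qed
    then show ?thesis by (auto simp: bounded_iff)
  qed
  ultimately show ?thesis by (simp add: compact_eq_bounded_closed vimage_def)
qed

lemma upper_ray: "upper z y = measure lborel ({s. y + s *\<^sub>R v \<in> K} \<inter> {height z y..})"
  unfolding upper_def by (rule arg_cong[where f = "measure lborel"]) auto

lemma cut_slice:
  assumes z: "z \<bullet> v > 0"
  shows "{s. y + s *\<^sub>R v \<in> {x \<in> K. 0 \<le> z \<bullet> (x - p)}} = {s. y + s *\<^sub>R v \<in> K \<and> height z y \<le> s}"
proof -
  have "0 \<le> z \<bullet> (y + s *\<^sub>R v - p) \<longleftrightarrow> height z y \<le> s" for s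
  proof -
    have "z \<bullet> (y + s *\<^sub>R v - p) = z \<bullet> (y - p) + s * (z \<bullet> v)"
      by (simp add: inner_diff_right inner_add_right)
    moreover have "height z y \<le> s \<longleftrightarrow> - (z \<bullet> (y - p)) \<le> s * (z \<bullet> v)"
      unfolding height_def using z by (rule pos_divide_le_eq)
    ultimately show ?thesis by linarith
  qed
  then show ?thesis by auto
qed

lemma upper_emeasure:
  assumes z: "z \<bullet> v > 0"
  shows "emeasure lborel {s. y + s *\<^sub>R v \<in> {x \<in> K. 0 \<le> z \<bullet> (x - p)}} = ennreal (upper z y)"
proof -
  have "bounded {s. y + s *\<^sub>R v \<in> K \<and> height z y \<le> s}"
    by (rule bounded_subset[OF compact_imp_bounded[OF fiber_compact[of y]]]) auto
  then have "emeasure lborel {s. y + s *\<^sub>R v \<in> K \<and> height z y \<le> s} < \<infinity>"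
    by (rule emeasure_bounded_finite)
  then show ?thesis unfolding cut_slice[OF z] upper_def
    by (simp add: emeasure_eq_ennreal_measure)
qed

lemma upper_measurable [measurable]: "upper z \<in> borel_measurable borel"
proof -
  let ?Q = "{q \<in> space (borel \<Otimes>\<^sub>M lborel). fst q + snd q *\<^sub>R v \<in> K \<and> height z (fst q) \<le> snd q}"
  have "?Q \<in> sets (borel \<Otimes>\<^sub>M lborel)" by measurable
  then have "(\<lambda>y. emeasure lborel (Pair y -` ?Q)) \<in> borel_measurable borel"
    by (rule lborel.measurable_emeasure_Pair)
  then have "(\<lambda>y. enn2real (emeasure lborel (Pair y -` ?Q))) \<in> borel_measurable borel"
    by measurable
  moreover have "Pair y -` ?Q = {s. y + s *\<^sub>R v \<in> K \<and> height z y \<le> s}" for y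
    by (auto simp: space_pair_measure)
  ultimately show ?thesis unfolding upper_def[abs_def] measure_def by simp
qed

lemma cut_volume_slices:
  assumes z: "z \<bullet> v > 0"
  shows "integrable N (upper z)" and "cut_volume K p z = (\<integral>y. upper z y \<partial>N)"
proof -
  let ?A = "{x \<in> K. 0 \<le> z \<bullet> (x - p)}"
  have A: "?A \<in> sets borel" by measurable
  have "bounded ?A" using compactK by (auto intro: bounded_subset compact_imp_bounded)
  then have fin: "emeasure lborel ?A < \<infinity>" by (rule emeasure_bounded_finite)
  have eq: "emeasure lborel ?A = (\<integral>\<^sup>+y. ennreal (upper z y) \<partial>N)"
    using emeasure_slices[OF A] by (simp only: upper_emeasure[OF z])
  have nn: "0 \<le> upper z y" for y by (simp add: upper_def)
  show "integrable N (upper z)"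
    using fin eq nn by (intro integrableI_nonneg) auto
  show "cut_volume K p z = (\<integral>y. upper z y \<partial>N)"
    unfolding cut_volume_def measure_def eq
    by (subst integral_eq_nn_integral) (auto simp: nn)
qed

lemma proj_affine:
  "u + w = 1 \<Longrightarrow> proj z (u *\<^sub>R x + w *\<^sub>R y) = u *\<^sub>R proj z x + w *\<^sub>R proj z y"
proof -
  assume uw: "u + w = 1"
  then have "u *\<^sub>R x + w *\<^sub>R y - p = u *\<^sub>R (x - p) + w *\<^sub>R (y - p)"
  proof -
    have "p = u *\<^sub>R p + w *\<^sub>R p" using uw by (metis scaleR_left_distrib scaleR_one)
    then have "u *\<^sub>R x + w *\<^sub>R y - p = u *\<^sub>R x + w *\<^sub>R y - (u *\<^sub>R p + w *\<^sub>R p)" by simp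
    then show ?thesis by (simp add: algebra_simps)
  qed
  then have "height z (u *\<^sub>R x + w *\<^sub>R y) = u * height z x + w * height z y"
    by (simp add: height_def inner_add_right add_divide_distrib diff_divide_distrib)
  then show ?thesis by (simp add: proj_def algebra_simps)
qed

lemma proj_p: "proj z p = p" by (simp add: proj_def height_def)

lemma proj_fiber: "z \<bullet> v \<noteq> 0 \<Longrightarrow> proj z (y + s *\<^sub>R v) = proj z y"
proof -
  assume z: "z \<bullet> v \<noteq> 0"
  have "height z (y + s *\<^sub>R v) = height z y - s"
    using z by (simp add: height_def inner_diff_right inner_add_right field_simps)
  then show ?thesis by (simp add: proj_def scaleR_diff_left)
qed

text \<open>
  The points that the projection sends to the boundary of \<open>K\<close> form a cylinder in the direction \<open>v\<close>. It
  lies in the frontier of the convex set of all points that are projected into \<open>K\<close>, and the frontier of a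
  convex set is a null set in the whole space.
\<close>

lemma AE_proj_regular:
  assumes z: "z \<bullet> v \<noteq> 0"
  shows "AE y in N. proj z y \<in> interior K \<or> proj z y \<notin> K"
proof -
  define C where "C = {y. proj z y \<in> K}"
  define D where "D = {y. proj z y \<in> K - interior K}"
  have [measurable]: "interior K \<in> sets borel" by simp
  have D: "D \<in> sets borel" unfolding D_def by measurable
  have "convex C"
    unfolding convex_def C_def using convexK by (auto simp: proj_affine convex_def)
  then have null: "negligible (frontier C)" by (rule negligible_convex_frontier)
  have "D \<subseteq> frontier C"
  proof
    fix y assume y: "y \<in> D"
    then have "y \<in> C" by (simp add: C_def D_def)
    then have "y \<in> closure C" using closure_subset by blast
    moreover have "y \<notin> interior C"
    proof
      assume "y \<in> interior C"
      then obtain e where e: "e > 0" "ball y e \<subseteq> C" by (auto simp: mem_interior)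
      \<comment> \<open>moving \<open>y\<close> away from \<open>p\<close> by the factor \<open>1 + d\<close>
        stays in the ball inside \<open>C\<close>\<close>
      define d where "d = e / (2 * (norm (y - p) + 1))"
      have d: "d > 0" using e by (simp add: d_def add_nonneg_pos)
      have "norm (d *\<^sub>R (y - p)) < e"
      proof -
        have "norm (d *\<^sub>R (y - p)) = d * norm (y - p)" using d by simp
        also have "\<dots> = e / 2 * (norm (y - p) / (norm (y - p) + 1))"
          by (simp add: d_def)
        also have "\<dots> \<le> e / 2 * 1"
          using e by (intro mult_left_mono) (auto simp: divide_le_eq_1 add_nonneg_pos)
        finally show ?thesis using e by simp
      qed
      then have "y + d *\<^sub>R (y - p) \<in> C" using e by (auto simp: dist_norm)
      moreover have "y + d *\<^sub>R (y - p) = (1 + d) *\<^sub>R y + (- d) *\<^sub>R p" by (simp add: algebra_simps)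
      ultimately have x: "(1 + d) *\<^sub>R proj z y + (- d) *\<^sub>R p \<in> K" (is "?x \<in> K")
        using proj_affine[of "1 + d" "- d" z y p] by (simp add: C_def proj_p)
      \<comment> \<open>\<open>proj z y\<close> lies strictly between the interior point \<open>p\<close> and a
        point of \<open>K\<close>\<close>
      have "?x - (d / (1 + d)) *\<^sub>R (?x - p) \<in> interior K"
        using d by (intro mem_interior_convex_shrink convexK pK x) auto
      moreover have "?x - (d / (1 + d)) *\<^sub>R (?x - p) = proj z y"
      proof -
        have "?x - p = (1 + d) *\<^sub>R (proj z y - p)" by (simp add: algebra_simps)
        then have "(d / (1 + d)) *\<^sub>R (?x - p) = d *\<^sub>R (proj z y - p)" using d by simp
        then show ?thesis by (simp add: algebra_simps)
      qed
      ultimately show False using y by (simp add: D_def)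
    qed
    ultimately show "y \<in> frontier C" by (simp add: frontier_def)
  qed
  then have "negligible D" using null by (rule negligible_subset[rotated])
  then have "emeasure lborel D = 0"
    using D by (simp add: negligible_iff_null_sets null_sets_completion_iff null_sets_def)
  then have "AE y in N. y \<notin> D"
    using D z by (intro AE_not_in_null_cylinder) (auto simp: D_def proj_fiber)
  then show ?thesis by eventually_elim (auto simp: D_def)
qed

text \<open>
  If the hyperplane is tilted by \<open>h\<close>, its height above \<open>y\<close> changes at the rate
  \<open>- (h \<bullet> (proj z y - p)) / (z \<bullet> v)\<close>, and the part of the fiber above it grows by the opposite amount
  when the fiber meets the hyperplane inside \<open>K\<close>.
\<close>

lemma upper_has_derivative:
  assumes z: "z \<bullet> v > 0" and reg: "proj z y \<in> interior K \<or> proj z y \<notin> K"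
  shows "((\<lambda>z. upper z y) has_derivative
      (\<lambda>h. indicator K (proj z y) * (h \<bullet> (proj z y - p)) / (z \<bullet> v))) (at z)"
proof -
  let ?I = "{s. y + s *\<^sub>R v \<in> K}"
  have "height z y \<in> interior ?I \<or> height z y \<notin> ?I"
  proof (cases "proj z y \<in> interior K")
    case True
    have "open ((\<lambda>s. y + s *\<^sub>R v) -` interior K)"
      by (intro open_vimage continuous_intros) auto
    moreover have "(\<lambda>s. y + s *\<^sub>R v) -` interior K \<subseteq> ?I" using interior_subset by auto
    ultimately have "height z y \<in> interior ?I"
      using True by (intro interiorI) (auto simp: proj_def)
    then show ?thesis ..
  next
    case False
    then show ?thesis using reg by (simp add: proj_def)
  qed
  from measure_ray_derivative[OF fiber_compact this]
  have D1: "((\<lambda>t. measure lborel (?I \<inter> {t..})) has_derivative (\<lambda>h. - indicator {s. y + s *\<^sub>R v \<in> K} (height z y) * h))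
      (at (height z y))"
    unfolding has_field_derivative_def by (rule has_derivative_eq_rhs) (simp add: fun_eq_iff)
  have D2: "((\<lambda>z. height z y) has_derivative (\<lambda>h. - (h \<bullet> (proj z y - p)) / (z \<bullet> v))) (at z)"
  proof -
    have "((\<lambda>z. height z y) has_derivative (\<lambda>h. - (((h \<bullet> (y - p)) * (z \<bullet> v)
        - (z \<bullet> (y - p)) * (h \<bullet> v)) / ((z \<bullet> v) * (z \<bullet> v))))) (at z)"
      unfolding height_def using z by (auto intro!: derivative_eq_intros)
    moreover have "- (((h \<bullet> (y - p)) * (z \<bullet> v) - (z \<bullet> (y - p)) * (h \<bullet> v)) / ((z \<bullet> v) * (z \<bullet> v)))
        = - (h \<bullet> (proj z y - p)) / (z \<bullet> v)" for h
    proof -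
      have "proj z y - p = (y - p) - (z \<bullet> (y - p) / (z \<bullet> v)) *\<^sub>R v"
        by (simp add: proj_def height_def)
      then have "h \<bullet> (proj z y - p) = h \<bullet> (y - p) - (z \<bullet> (y - p)) / (z \<bullet> v) * (h \<bullet> v)"
        by (simp only: inner_diff_right[of h "y - p"] inner_scaleR_right)
      also have "\<dots> / (z \<bullet> v) = ((h \<bullet> (y - p)) * (z \<bullet> v) - (z \<bullet> (y - p)) * (h \<bullet> v)) / ((z \<bullet> v) * (z \<bullet> v))"
        using z by (simp add: divide_simps)
      finally show ?thesis by (metis minus_divide_left)
    qed
    ultimately show ?thesis by (simp only:)
  qed
  have D3: "((\<lambda>z. measure lborel (?I \<inter> {height z y..})) has_derivative
      (\<lambda>h. - indicator ?I (height z y) * (- (h \<bullet> (proj z y - p)) / (z \<bullet> v)))) (at z)"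
    by (rule has_derivative_compose[OF D2 D1])
  have "indicator ?I (height z y) = (indicator K (proj z y) :: real)"
    by (simp add: proj_def indicator_def)
  then have "- indicator ?I (height z y) * (- (h \<bullet> (proj z y - p)) / (z \<bullet> v))
      = indicator K (proj z y) * (h \<bullet> (proj z y - p)) / (z \<bullet> v)" for h by simp
  with D3 show ?thesis unfolding upper_ray by (simp only:)
qed

end

context body_frame
begin

lemma obtain_radius: obtains R where "R > 0" "K \<subseteq> cball p R"
proof -
  obtain R where "R > 0" "\<forall>x\<in>K. norm (x - p) \<le> R"
  proof -
    have "bounded ((\<lambda>x. x - p) ` K)" using compact_imp_bounded[OF compactK] by (rule bounded_translation_minus)
    then show ?thesis using that unfolding bounded_pos by blast
  qed
  then have "K \<subseteq> cball p R" by (auto simp: dist_norm norm_minus_commute)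
  then show ?thesis using that[of R] \<open>R > 0\<close> by blast
qed

text \<open>
  An orthogonal projection does not increase the distance to a point of the hyperplane. Fibers over
  points at distance more than \<open>R\<close> from \<open>p\<close> therefore miss the ball of radius \<open>R\<close>.
\<close>

lemma norm_base_le:
  assumes "v \<bullet> (y - p) = 0"
  shows "norm (y - p) \<le> norm (y + s *\<^sub>R v - p)"
proof -
  have "(norm (y + s *\<^sub>R v - p))\<^sup>2 = (norm ((y - p) + s *\<^sub>R v))\<^sup>2" by (simp add: algebra_simps)
  also have "\<dots> = (norm (y - p))\<^sup>2 + s\<^sup>2"
    using assms vv unfolding power2_norm_eq_inner
    by (simp add: inner_add_left inner_add_right inner_commute power2_eq_square)
  finally have "(norm (y - p))\<^sup>2 \<le> (norm (y + s *\<^sub>R v - p))\<^sup>2" by simp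
  then show ?thesis by (rule power2_le_imp_le) simp
qed

lemma integrable_N_cball_const: "integrable N (\<lambda>y. W * indicator (cball p R) y :: real)"
proof -
  have "emeasure N (cball p R) < \<infinity>" by (intro emeasure_N_bounded) auto
  then show ?thesis by (intro integrable_mult_right integrable_real_indicator) auto
qed

lemma moment_integrand_bound:
  assumes R: "R > 0" "K \<subseteq> cball p R" and y: "v \<bullet> (y - p) = 0"
  shows "norm (indicator K (proj z y) *\<^sub>R (proj z y - p)) \<le> R * indicator (cball p R) y"
proof (cases "proj z y \<in> K")
  case True
  then have "norm (proj z y - p) \<le> R" using R by (auto simp: dist_norm norm_minus_commute)
  moreover have "norm (y - p) \<le> norm (proj z y - p)"
    unfolding proj_def using y by (rule norm_base_le)
  ultimately show ?thesis using True by (simp add: dist_norm norm_minus_commute)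
qed (use R in auto)

lemma moment_integrable: "integrable N (\<lambda>y. indicator K (proj z y) *\<^sub>R (proj z y - p))"
proof -
  obtain R where R: "R > 0" "K \<subseteq> cball p R" by (rule obtain_radius)
  show ?thesis
  proof (rule Bochner_Integration.integrable_bound[OF integrable_N_cball_const[of R R]])
    show "AE y in N. norm (indicator K (proj z y) *\<^sub>R (proj z y - p)) \<le> norm (R * indicator (cball p R) y)"
      using AE_mem
    proof eventually_elim
      case (elim y)
      then show ?case using moment_integrand_bound[OF R elim, of z] R by simp
    qed
  qed measurable
qed

text \<open>
  Dominated convergence: almost every point of the base is projected either into the interior of \<open>K\<close> or
  outside the closed set \<open>K\<close>, and this persists for nearby directions.
\<close>

lemma moment_continuous: "continuous_on {z. z \<bullet> v > 0} moment"
proof -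
  obtain R where R: "R > 0" "K \<subseteq> cball p R" by (rule obtain_radius)
  let ?f = "\<lambda>z y. indicator K (proj z y) *\<^sub>R (proj z y - p)"
  have "(\<lambda>n. moment (X n)) \<longlonglongrightarrow> moment z"
    if z: "z \<bullet> v > 0" and Xv: "\<And>n. X n \<bullet> v > 0" and X: "X \<longlonglongrightarrow> z" for X z
  proof -
    have "(\<lambda>n. \<integral>y. ?f (X n) y \<partial>N) \<longlonglongrightarrow> (\<integral>y. ?f z y \<partial>N)"
    proof (rule integral_dominated_convergence[OF _ _ integrable_N_cball_const[of R R]])
      show "AE y in N. (\<lambda>n. ?f (X n) y) \<longlonglongrightarrow> ?f z y"
        using AE_proj_regular[OF less_imp_neq[OF z, symmetric]]
      proof eventually_elim
        case (elim y)
        have lim: "(\<lambda>n. proj (X n) y) \<longlonglongrightarrow> proj z y"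
          unfolding proj_def height_def using z by (intro tendsto_intros X) auto
        have "\<forall>\<^sub>F n in sequentially. (indicator K (proj (X n) y) :: real) = indicator K (proj z y)"
          using elim
        proof
          assume "proj z y \<in> interior K"
          then have "\<forall>\<^sub>F n in sequentially. proj (X n) y \<in> interior K"
            using lim by (intro topological_tendstoD) auto
          then show ?thesis
            by eventually_elim (use \<open>proj z y \<in> interior K\<close> interior_subset in \<open>auto simp: indicator_def\<close>)
        next
          assume "proj z y \<notin> K"
          then have "\<forall>\<^sub>F n in sequentially. proj (X n) y \<in> - K"
            using lim compactK by (intro topological_tendstoD) (auto simp: compact_imp_closed open_Compl)
          then show ?thesis by eventually_elim (use \<open>proj z y \<notin> K\<close> in auto)
        qed
        then have "(\<lambda>n. indicator K (proj (X n) y) :: real) \<longlonglongrightarrow> indicator K (proj z y)"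
          by (rule tendsto_eventually)
        then show ?case using lim by (intro tendsto_intros)
      qed
      show "AE y in N. norm (?f (X n) y) \<le> R * indicator (cball p R) y" for n
        using AE_mem by eventually_elim (rule moment_integrand_bound[OF R])
    qed measurable
    then show ?thesis unfolding moment_def using z by (intro tendsto_intros X) auto
  qed
  then show ?thesis unfolding continuous_on_sequentially comp_def by auto
qed

text \<open>
  The dominating function for the difference quotients of \<open>upper\<close>. It rests on the exact formula
  \<open>height x y - height z y = - ((x - z) \<bullet> (proj z y - p)) / (x \<bullet> v)\<close>.
\<close>

lemma upper_increment_bound:
  assumes R: "R > 0" "K \<subseteq> cball p R" and y: "v \<bullet> (y - p) = 0"
    and z: "z \<bullet> v > 0" and x: "x \<bullet> v > (z \<bullet> v) / 2"
  shows "\<bar>upper x y - upper z y - indicator K (proj z y) * ((x - z) \<bullet> (proj z y - p)) / (z \<bullet> v)\<bar>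
    \<le> norm (x - z) * ((R * (1 + norm z / (z \<bullet> v)) * 3 / (z \<bullet> v)) * indicator (cball p R) y)"
proof (cases "y \<in> cball p R")
  case False
  have noK: "y + s *\<^sub>R v \<notin> K" for s
  proof
    assume "y + s *\<^sub>R v \<in> K"
    then have "norm (y + s *\<^sub>R v - p) \<le> R" using R by (auto simp: dist_norm norm_minus_commute)
    then show False using False norm_base_le[OF y, of s] by (simp add: dist_norm norm_minus_commute)
  qed
  then show ?thesis using False by (simp add: upper_def proj_def)
next
  case True
  let ?q = "proj z y - p"
  have xv: "x \<bullet> v > 0" using x z by simp
  have q: "?q = (y - p) + height z y *\<^sub>R v" by (simp add: proj_def)
  have zq: "z \<bullet> ?q = 0" using z unfolding q inner_add_right height_def by simp
  have "height x y - height z y = - ((x - z) \<bullet> ?q) / (x \<bullet> v)"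
  proof -
    have "(x - z) \<bullet> ?q = x \<bullet> (y - p) + height z y * (x \<bullet> v)"
      using zq unfolding inner_diff_left by (simp add: q inner_add_right)
    then show ?thesis using xv by (simp add: height_def[of x] field_simps)
  qed
  then have "\<bar>height x y - height z y\<bar> = \<bar>(x - z) \<bullet> ?q\<bar> / (x \<bullet> v)"
    using xv by (simp add: abs_minus_cancel)
  also have "\<dots> \<le> (norm (x - z) * norm ?q) / ((z \<bullet> v) / 2)"
    using x z by (intro frac_le Cauchy_Schwarz_ineq2) auto
  finally have h: "\<bar>height x y - height z y\<bar> \<le> 2 * (norm (x - z) * norm ?q / (z \<bullet> v))"
    by (simp add: field_simps)
  have u: "\<bar>upper x y - upper z y\<bar> \<le> \<bar>height x y - height z y\<bar>"
    unfolding upper_ray by (rule measure_ray_lipschitz[OF fiber_compact])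
  have c: "\<bar>indicator K (proj z y) * ((x - z) \<bullet> ?q) / (z \<bullet> v)\<bar> \<le> norm (x - z) * norm ?q / (z \<bullet> v)"
  proof -
    have "\<bar>indicator K (proj z y) * ((x - z) \<bullet> ?q)\<bar> \<le> norm (x - z) * norm ?q"
      using Cauchy_Schwarz_ineq2[of "x - z" ?q] by (auto simp: indicator_def)
    then show ?thesis using z by (simp add: abs_divide divide_right_mono)
  qed
  have "norm ?q \<le> R * (1 + norm z / (z \<bullet> v))"
  proof -
    have yR: "norm (y - p) \<le> R" using True by (simp add: dist_norm norm_minus_commute)
    have "\<bar>height z y\<bar> = \<bar>z \<bullet> (y - p)\<bar> / (z \<bullet> v)"
      using z by (simp add: height_def)
    also have "\<dots> \<le> (norm z * R) / (z \<bullet> v)"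
    proof (rule divide_right_mono)
      have "\<bar>z \<bullet> (y - p)\<bar> \<le> norm z * norm (y - p)" by (rule Cauchy_Schwarz_ineq2)
      also have "\<dots> \<le> norm z * R" using yR by (intro mult_left_mono) auto
      finally show "\<bar>z \<bullet> (y - p)\<bar> \<le> norm z * R" .
    qed (use z in simp)
    finally have "norm (height z y *\<^sub>R v) \<le> norm z * R / (z \<bullet> v)" by (simp add: v1)
    then have "norm ?q \<le> R + norm z * R / (z \<bullet> v)"
      unfolding q using yR norm_triangle_ineq[of "y - p" "height z y *\<^sub>R v"] by linarith
    then show ?thesis by (simp add: algebra_simps)
  qed
  then have "norm (x - z) * norm ?q / (z \<bullet> v) \<le> norm (x - z) * (R * (1 + norm z / (z \<bullet> v))) / (z \<bullet> v)"
    using z by (intro divide_right_mono mult_left_mono) auto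
  moreover have "\<bar>upper x y - upper z y - indicator K (proj z y) * ((x - z) \<bullet> ?q) / (z \<bullet> v)\<bar>
      \<le> 3 * (norm (x - z) * norm ?q / (z \<bullet> v))"
    using h u c by linarith
  ultimately have "\<bar>upper x y - upper z y - indicator K (proj z y) * ((x - z) \<bullet> ?q) / (z \<bullet> v)\<bar>
      \<le> 3 * (norm (x - z) * (R * (1 + norm z / (z \<bullet> v))) / (z \<bullet> v))" by linarith
  also have "\<dots> = norm (x - z) * (R * (1 + norm z / (z \<bullet> v)) * 3 / (z \<bullet> v))" by simp
  finally show ?thesis using True by simp
qed

text \<open>
  Differentiation under the integral sign, by dominated convergence of the difference quotients.
\<close>

lemma cut_volume_has_derivative:
  assumes z: "z \<bullet> v > 0"
  shows "(cut_volume K p has_derivative (\<lambda>h. moment z \<bullet> h)) (at z)"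
proof -
  obtain R where R: "R > 0" "K \<subseteq> cball p R" by (rule obtain_radius)
  \<comment> \<open>on this neighborhood of \<open>z\<close> the bound on the difference quotients is uniform\<close>
  define S where "S = {x. x \<bullet> v > (z \<bullet> v) / 2}"
  have openS: "open S" unfolding S_def by (intro open_Collect_less continuous_intros)
  have zS: "z \<in> S" using z by (simp add: S_def)
  have atS: "at z within S = at z" by (rule at_within_open[OF zS openS])
  let ?W = "R * (1 + norm z / (z \<bullet> v)) * 3 / (z \<bullet> v)"
  let ?d = "\<lambda>x y. indicator K (proj z y) * ((x - z) \<bullet> (proj z y - p)) / (z \<bullet> v)"
  let ?e = "\<lambda>x y. (upper x y - upper z y - ?d x y) / norm (x - z)"
  have d_int: "integrable N (?d x)" and d_eq: "(\<integral>y. ?d x y \<partial>N) = moment z \<bullet> (x - z)" for x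
  proof -
    have *: "?d x y = (1 / (z \<bullet> v)) * ((x - z) \<bullet> (indicator K (proj z y) *\<^sub>R (proj z y - p)))" for y
      by simp
    have i: "integrable N (\<lambda>y. (x - z) \<bullet> (indicator K (proj z y) *\<^sub>R (proj z y - p)))"
      using moment_integrable by (rule integrable_inner_right)
    show "integrable N (?d x)" unfolding * using i by (rule integrable_mult_right)
    have "(\<integral>y. ?d x y \<partial>N)
        = (1 / (z \<bullet> v)) * ((x - z) \<bullet> (\<integral>y. indicator K (proj z y) *\<^sub>R (proj z y - p) \<partial>N))"
      unfolding * by (subst integral_mult_right_zero) (simp only: integral_inner_right[OF moment_integrable])
    then show "(\<integral>y. ?d x y \<partial>N) = moment z \<bullet> (x - z)"
      by (simp add: moment_def inner_commute)
  qed
  have e_int: "(\<integral>y. ?e x y \<partial>N)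
      = (cut_volume K p x - cut_volume K p z - moment z \<bullet> (x - z)) / norm (x - z)" if "x \<in> S" for x
  proof -
    have xv: "x \<bullet> v > 0" using that z by (simp add: S_def)
    have "(\<integral>y. upper x y - upper z y - ?d x y \<partial>N)
        = cut_volume K p x - cut_volume K p z - moment z \<bullet> (x - z)"
      using cut_volume_slices[OF xv] cut_volume_slices[OF z] d_int[of x] d_eq[of x]
      by (subst Bochner_Integration.integral_diff; simp?)
    then show ?thesis by simp
  qed
  have "((\<lambda>x. (cut_volume K p x - cut_volume K p z - moment z \<bullet> (x - z)) / norm (x - z)) \<longlongrightarrow> 0)
      (at z within S)"
    unfolding tendsto_at_iff_sequentially comp_def
  proof (intro allI impI)
    fix X assume XS: "\<forall>i. X i \<in> S - {z}" and X: "X \<longlonglongrightarrow> z"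
    have "(\<lambda>n. \<integral>y. ?e (X n) y \<partial>N) \<longlonglongrightarrow> (\<integral>y. 0 \<partial>N)"
    proof (rule integral_dominated_convergence[OF _ _ integrable_N_cball_const[of ?W R]])
      show "AE y in N. (\<lambda>n. ?e (X n) y) \<longlonglongrightarrow> 0"
        using AE_proj_regular[OF less_imp_neq[OF z, symmetric]]
      proof eventually_elim
        case (elim y)
        have "((\<lambda>x. norm (upper x y - upper z y - ?d x y) / norm (x - z)) \<longlongrightarrow> 0) (at z)"
          using upper_has_derivative[OF z elim] unfolding has_derivative_iff_norm by simp
        then have "(\<lambda>n. norm (upper (X n) y - upper z y - ?d (X n) y) / norm (X n - z)) \<longlonglongrightarrow> 0"
          using X XS unfolding tendsto_at_iff_sequentially comp_def by auto
        then have "(\<lambda>n. norm (?e (X n) y)) \<longlonglongrightarrow> 0" by (simp add: norm_divide)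
        then show ?case by (rule tendsto_norm_zero_cancel)
      qed
      show "AE y in N. norm (?e (X n) y) \<le> ?W * indicator (cball p R) y" for n
        using AE_mem
      proof eventually_elim
        case (elim y)
        have "X n \<bullet> v > (z \<bullet> v) / 2" and ne: "norm (X n - z) > 0" using XS by (auto simp: S_def)
        from upper_increment_bound[OF R elim z this(1)] ne show ?case
          by (simp add: norm_divide divide_le_eq mult_ac)
      qed
    qed measurable
    moreover have "(\<integral>y. ?e (X n) y \<partial>N) = (cut_volume K p (X n) - cut_volume K p z - moment z \<bullet> (X n - z)) / norm (X n - z)" for n
      using XS by (intro e_int) auto
    ultimately show "(\<lambda>n. (cut_volume K p (X n) - cut_volume K p z - moment z \<bullet> (X n - z)) / norm (X n - z)) \<longlonglongrightarrow> 0"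
      by (simp only: Bochner_Integration.integral_zero)
  qed
  then have "((\<lambda>x. norm (cut_volume K p x - cut_volume K p z - moment z \<bullet> (x - z)) / norm (x - z)) \<longlongrightarrow> 0) (at z)"
    unfolding atS by (drule_tac tendsto_norm_zero) (simp add: norm_divide)
  then show ?thesis
    unfolding has_derivative_iff_norm by (simp add: bounded_linear_inner_right)
qed

text \<open>
  For \<open>z = v\<close> the projection fixes the points of the hyperplane, so \<open>moment v\<close> is the first moment of the
  section about \<open>p\<close>.
\<close>

lemma barycenter_if_moment_zero:
  assumes leb: "lebesgue_of {x. v \<bullet> (x - p) = 0} = completion N" and zero: "moment v = 0"
  shows "is_barycenter p {x. v \<bullet> (x - p) = 0} (K \<inter> {x. v \<bullet> (x - p) = 0})"
proof -
  let ?h = "{x. v \<bullet> (x - p) = 0}"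
  let ?Y = "K \<inter> ?h"
  have h[measurable]: "?h \<in> sets borel" by measurable
  have Y[measurable]: "?Y \<in> sets borel" by measurable
  then have YN: "?Y \<in> sets N" by simp
  have bddY: "bounded ?Y" using compactK by (auto intro: bounded_subset compact_imp_bounded)
  then have finY: "emeasure N ?Y < \<infinity>" by (intro emeasure_N_bounded) auto
  have posY: "measure N ?Y > 0"
  proof (rule ccontr)
    assume "\<not> measure N ?Y > 0"
    then have "emeasure N ?Y = 0"
      using finY by (metis emeasure_eq_ennreal_measure ennreal_0 infinity_ennreal_def less_le measure_nonneg not_less order_less_irrefl)
    then have "?Y \<in> null_sets N" using YN by (simp add: null_sets_def)
    then have ae: "AE y in N. y \<notin> ?Y" by (rule AE_not_in)
    \<comment> \<open>every fiber that meets a ball around \<open>p\<close> has its base point in the ball, so a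
      null section would make the ball a null set\<close>
    obtain r where r: "r > 0" "ball p r \<subseteq> K" using pK by (auto simp: mem_interior)
    have "emeasure lborel (ball p r) = (\<integral>\<^sup>+y. emeasure lborel {s. y + s *\<^sub>R v \<in> ball p r} \<partial>N)"
      by (rule emeasure_slices) simp
    also have "\<dots> = (\<integral>\<^sup>+y. 0 \<partial>N)"
    proof (rule nn_integral_cong_AE, use ae AE_mem in eventually_elim)
      fix y assume y: "y \<notin> ?Y" "v \<bullet> (y - p) = 0"
      have "y + s *\<^sub>R v \<notin> ball p r" for s
      proof
        assume "y + s *\<^sub>R v \<in> ball p r"
        then have "y \<in> ball p r" using norm_base_le[OF y(2), of s]
          by (simp add: dist_norm norm_minus_commute)
        then show False using y r by auto
      qed
      then show "emeasure lborel {s. y + s *\<^sub>R v \<in> ball p r} = 0" by simp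
    qed
    finally have "emeasure lborel (ball p r) = 0" by simp
    then show False using content_ball_pos[OF r(1), of p] by (simp add: measure_def)
  qed
  have ae: "AE y in N. indicator K (proj v y) *\<^sub>R (proj v y - p) = indicator ?Y y *\<^sub>R y - indicator ?Y y *\<^sub>R p"
    using AE_mem
  proof eventually_elim
    case (elim y)
    then have "proj v y = y" by (simp add: proj_def height_def)
    then show ?case using elim by (cases "y \<in> K") simp_all
  qed
  have meas: "(\<lambda>y. indicator K (proj v y) *\<^sub>R (proj v y - p)) \<in> borel_measurable N"
    "(\<lambda>y. indicator ?Y y *\<^sub>R y - indicator ?Y y *\<^sub>R p) \<in> borel_measurable N" by measurable
  have diff_int: "integrable N (\<lambda>y. indicator ?Y y *\<^sub>R y - indicator ?Y y *\<^sub>R p)"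
    using integrable_cong_AE[OF meas ae] moment_integrable[of v] by blast
  have intp: "integrable N (\<lambda>y. indicator ?Y y *\<^sub>R p)"
    using YN finY by (intro integrable_scaleR_left integrable_real_indicator) auto
  have inty: "integrable N (\<lambda>y. indicator ?Y y *\<^sub>R y)"
    using Bochner_Integration.integrable_add[OF diff_int intp] by simp
  have "0 = (\<integral>y. indicator K (proj v y) *\<^sub>R (proj v y - p) \<partial>N)"
    using zero vv by (simp add: moment_def)
  also have "\<dots> = (\<integral>y. indicator ?Y y *\<^sub>R y - indicator ?Y y *\<^sub>R p \<partial>N)"
    by (rule integral_cong_AE[OF meas ae])
  also have "\<dots> = (\<integral>y. indicator ?Y y *\<^sub>R y \<partial>N) - (\<integral>y. indicator ?Y y *\<^sub>R p \<partial>N)"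
    by (rule Bochner_Integration.integral_diff[OF inty intp])
  also have "(\<integral>y. indicator ?Y y *\<^sub>R p \<partial>N) = measure N ?Y *\<^sub>R p"
    using YN finY by (subst integral_scaleR_left) auto
  finally have *: "(\<integral>y. indicator ?Y y *\<^sub>R y \<partial>N) = measure N ?Y *\<^sub>R p" by simp
  have m: "measure (completion N) ?Y = measure N ?Y" using YN by (rule measure_completion)
  have "(LINT x:?Y|completion N. x) = (\<integral>y. indicator ?Y y *\<^sub>R y \<partial>N)"
    unfolding set_lebesgue_integral_def by (rule integral_completion) measurable
  then show ?thesis
    unfolding is_barycenter_def leb m using bddY YN posY * by (auto simp: sets_completionI_sets)
qed

end

section \<open>A mountain pass for functions of the direction\<close>

text \<open>
  A function of the direction is treated as a function on the punctured space that is constant on rays.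
  Its gradient is then tangent to the spheres, and derivatives in the ambient space suffice.
\<close>

locale homogeneous_C1 =
  fixes f :: "'a::euclidean_space \<Rightarrow> real" and g :: "'a \<Rightarrow> 'a"
  assumes hom: "c > 0 \<Longrightarrow> f (c *\<^sub>R x) = f x"
    and deriv: "x \<noteq> 0 \<Longrightarrow> (f has_derivative (\<lambda>h. g x \<bullet> h)) (at x)"
    and cont: "continuous_on (- {0}) g"
begin

lemma f_continuous: "continuous_on (- {0}) f"
  using deriv by (intro continuous_at_imp_continuous_on) (auto intro: has_derivative_continuous)

lemma f_sgn: "x \<noteq> 0 \<Longrightarrow> f (sgn x) = f x"
  using hom[of "inverse (norm x)" x] by (simp add: sgn_div_norm)

lemma gradient_orthogonal:
  assumes x: "x \<noteq> 0"
  shows "g x \<bullet> x = 0"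
proof -
  have "((\<lambda>t::real. f (t *\<^sub>R x)) has_derivative (\<lambda>h. g (1 *\<^sub>R x) \<bullet> (h *\<^sub>R x))) (at 1)"
  proof (rule has_derivative_compose[where f = "\<lambda>t::real. t *\<^sub>R x" and g = f])
    show "((\<lambda>t::real. t *\<^sub>R x) has_derivative (\<lambda>h. h *\<^sub>R x)) (at 1)"
      by (auto intro!: derivative_eq_intros)
    show "(f has_derivative (\<lambda>h. g (1 *\<^sub>R x) \<bullet> h)) (at (1 *\<^sub>R x))" using deriv[OF x] by simp
  qed
  moreover have "((\<lambda>t::real. f (t *\<^sub>R x)) has_derivative (\<lambda>h. 0)) (at 1)"
    by (rule has_derivative_transform_within_open[OF has_derivative_const[of "f x"], of "{0<..}"])
       (auto simp: hom)
  ultimately have "(\<lambda>h::real. g (1 *\<^sub>R x) \<bullet> (h *\<^sub>R x)) = (\<lambda>h. 0)" by (rule has_derivative_unique)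
  from fun_cong[OF this, of 1] show ?thesis by simp
qed

lemma gradient_step_mvt:
  assumes x: "norm x = 1" and t: "t > 0"
  obtains s where "0 < s" "s < t"
    "f (x - t *\<^sub>R g x) - f x = - t * (g (x - s *\<^sub>R g x) \<bullet> g x)"
proof -
  have xx: "x \<bullet> x = 1" and x0: "x \<noteq> 0" using x by (auto simp: dot_square_norm)
  have ne: "x - s *\<^sub>R g x \<noteq> 0" for s
  proof
    assume "x - s *\<^sub>R g x = 0"
    then have "(x - s *\<^sub>R g x) \<bullet> x = 0" by simp
    then show False using gradient_orthogonal[OF x0] xx by (simp add: inner_diff_left)
  qed
  have D: "((\<lambda>s. f (x - s *\<^sub>R g x)) has_real_derivative - (g (x - s *\<^sub>R g x) \<bullet> g x)) (at s)" for s
  proof -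
    have "((\<lambda>s::real. x - s *\<^sub>R g x) has_derivative (\<lambda>h. - (h *\<^sub>R g x))) (at s)"
      by (auto intro!: derivative_eq_intros)
    from has_derivative_compose[OF this deriv[OF ne]]
    show ?thesis unfolding has_field_derivative_def
      by (rule has_derivative_eq_rhs) (simp add: fun_eq_iff)
  qed
  from MVT2[OF t D] obtain s where "0 < s" "s < t"
    "f (x - t *\<^sub>R g x) - f (x - 0 *\<^sub>R g x) = (t - 0) * - (g (x - s *\<^sub>R g x) \<bullet> g x)" by auto
  then show ?thesis by (intro that[of s]) auto
qed

lemma norm_step_ge_1: "norm x = 1 \<Longrightarrow> norm (x - s *\<^sub>R g x) \<ge> 1"
proof -
  assume x: "norm x = 1"
  then have "g x \<bullet> x = 0" by (intro gradient_orthogonal) auto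
  then have "(x - s *\<^sub>R g x) \<bullet> x = 1" using x by (simp add: inner_diff_left dot_square_norm)
  then show ?thesis using Cauchy_Schwarz_ineq2[of "x - s *\<^sub>R g x" x] x by simp
qed

text \<open>
  A single step of gradient descent with a uniform step length \<open>t\<close> replaces the gradient flow. By the
  mean value theorem and the uniform continuity of \<open>g\<close> it lowers \<open>f\<close> by a fixed amount wherever the
  gradient is not small, and it raises \<open>f\<close> by little elsewhere.
\<close>

lemma gradient_step_decreases:
  assumes \<mu>: "\<mu> > 0"
  obtains t where "t > 0"
    "\<And>x. norm x = 1 \<Longrightarrow> norm (g x) \<ge> \<mu> \<Longrightarrow> f (x - t *\<^sub>R g x) \<le> f x - t * \<mu>\<^sup>2 / 2"
    "\<And>x. norm x = 1 \<Longrightarrow> f (x - t *\<^sub>R g x) \<le> f x + \<mu> / 2"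
proof -
  \<comment> \<open>a step from the unit sphere does not enter the unit ball, as the gradient is tangent to
    the sphere; steps of length at most 1 stay in this compact shell\<close>
  define A where "A = cball (0::'a) 2 - ball 0 1"
  have A: "compact A" "A \<subseteq> - {0}" unfolding A_def by (auto intro!: compact_diff)
  have contA: "continuous_on A g" using cont A(2) by (rule continuous_on_subset)
  have "bounded (g ` A)" using compact_continuous_image[OF contA A(1)] by (rule compact_imp_bounded)
  then obtain G where G: "G > 0" "\<And>x. x \<in> A \<Longrightarrow> norm (g x) \<le> G" by (auto simp: bounded_pos)
  have "uniformly_continuous_on A g" using contA A(1) by (rule compact_uniformly_continuous)
  then obtain \<eta> where \<eta>: "\<eta> > 0"
    "\<And>x y. x \<in> A \<Longrightarrow> y \<in> A \<Longrightarrow> dist y x < \<eta> \<Longrightarrow> dist (g y) (g x) < \<mu> / 2"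
    unfolding uniformly_continuous_on_def using half_gt_zero[OF \<mu>] by blast
  define t where "t = min (\<eta> / (2 * G)) (min (1 / G) (\<mu> / (2 * G\<^sup>2)))"
  have t: "t > 0" using \<eta>(1) G(1) \<mu> by (simp add: t_def)
  have tG: "t * G < \<eta>" "t * G \<le> 1" "t * G\<^sup>2 \<le> \<mu> / 2"
  proof -
    have "t * G \<le> \<eta> / (2 * G) * G" using G(1) by (intro mult_right_mono) (auto simp: t_def)
    also have "\<dots> < \<eta>" using G(1) \<eta>(1) by simp
    finally show "t * G < \<eta>" .
    have "t * G \<le> 1 / G * G" using G(1) by (intro mult_right_mono) (auto simp: t_def)
    then show "t * G \<le> 1" using G(1) by simp
    have "t * G\<^sup>2 \<le> \<mu> / (2 * G\<^sup>2) * G\<^sup>2" by (intro mult_right_mono) (auto simp: t_def)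
    then show "t * G\<^sup>2 \<le> \<mu> / 2" using G(1) by simp
  qed
  have step: "x - s *\<^sub>R g x \<in> A \<and> dist (x - s *\<^sub>R g x) x < \<eta>" if x: "norm x = 1" and s: "0 < s" "s < t" for x s
  proof -
    have "norm (g x) \<le> G" using x by (intro G(2)) (auto simp: A_def)
    then have "norm (s *\<^sub>R g x) \<le> t * G" using s G(1) by (simp add: mult_mono)
    then have "norm (x - s *\<^sub>R g x) \<le> 2" "dist (x - s *\<^sub>R g x) x < \<eta>"
      using x tG norm_triangle_ineq4[of x "s *\<^sub>R g x"] by (auto simp: dist_norm)
    then show ?thesis using norm_step_ge_1[OF x, of s] by (auto simp: A_def)
  qed
  have xA: "x \<in> A" if "norm x = 1" for x using that by (simp add: A_def)
  show ?thesis
  proof (rule that[OF t])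
    fix x :: 'a assume x: "norm x = 1" and gx: "norm (g x) \<ge> \<mu>"
    obtain s where s: "0 < s" "s < t"
      and eq: "f (x - t *\<^sub>R g x) - f x = - t * (g (x - s *\<^sub>R g x) \<bullet> g x)"
      using gradient_step_mvt[OF x t] .
    let ?\<xi> = "x - s *\<^sub>R g x"
    have near: "norm (g ?\<xi> - g x) \<le> \<mu> / 2"
      using \<eta>(2)[OF xA[OF x], of ?\<xi>] step[OF x s] by (simp add: dist_norm)
    have "\<bar>(g ?\<xi> - g x) \<bullet> g x\<bar> \<le> norm (g ?\<xi> - g x) * norm (g x)" by (rule Cauchy_Schwarz_ineq2)
    also have "\<dots> \<le> \<mu> / 2 * norm (g x)" using near by (rule mult_right_mono) simp
    also have "\<dots> \<le> norm (g x) / 2 * norm (g x)" using gx by (intro mult_right_mono) auto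
    also have "\<dots> = (norm (g x))\<^sup>2 / 2" by (simp add: power2_eq_square)
    finally have "- ((norm (g x))\<^sup>2 / 2) \<le> (g ?\<xi> - g x) \<bullet> g x" by linarith
    moreover have "g ?\<xi> \<bullet> g x = (g ?\<xi> - g x) \<bullet> g x + (norm (g x))\<^sup>2"
      by (simp add: inner_diff_left dot_square_norm)
    ultimately have "g ?\<xi> \<bullet> g x \<ge> (norm (g x))\<^sup>2 / 2" by linarith
    moreover have "(norm (g x))\<^sup>2 \<ge> \<mu>\<^sup>2" using gx \<mu> by (intro power_mono) auto
    ultimately have "g ?\<xi> \<bullet> g x \<ge> \<mu>\<^sup>2 / 2" by linarith
    then have "t * (\<mu>\<^sup>2 / 2) \<le> t * (g ?\<xi> \<bullet> g x)" using t by (intro mult_left_mono) auto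
    then show "f (x - t *\<^sub>R g x) \<le> f x - t * \<mu>\<^sup>2 / 2" using eq by simp
  next
    fix x :: 'a assume x: "norm x = 1"
    obtain s where s: "0 < s" "s < t"
      and eq: "f (x - t *\<^sub>R g x) - f x = - t * (g (x - s *\<^sub>R g x) \<bullet> g x)"
      using gradient_step_mvt[OF x t] .
    have "\<bar>g (x - s *\<^sub>R g x) \<bullet> g x\<bar> \<le> norm (g (x - s *\<^sub>R g x)) * norm (g x)" by (rule Cauchy_Schwarz_ineq2)
    also have "\<dots> \<le> G * G" using G step[OF x s] xA[OF x] by (intro mult_mono) auto
    finally have "- (g (x - s *\<^sub>R g x) \<bullet> g x) \<le> G\<^sup>2" by (simp add: power2_eq_square)
    then have "t * (- (g (x - s *\<^sub>R g x) \<bullet> g x)) \<le> t * G\<^sup>2" using t by (intro mult_left_mono) auto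
    then show "f (x - t *\<^sub>R g x) \<le> f x + \<mu> / 2" using eq tG(3) by simp
  qed
qed

abbreviation "sublevel t \<equiv> {z. z \<noteq> 0 \<and> f z < t}"

text \<open>
  Let \<open>c\<close> be the infimum of the levels below which \<open>x\<close> and \<open>y\<close> are connected by a path. If there were no
  critical point at level \<open>c\<close>, a gradient step, applied to a path that stays below \<open>c + \<kappa>\<close>, would give a
  path below \<open>c - \<kappa> / 2\<close>; its end points do not move because they are critical.
\<close>

lemma mountain_pass:
  assumes x: "norm x = 1" "g x = 0" and y: "norm y = 1" "g y = 0"
    and b: "path_component (sublevel b) x y" and a: "\<not> path_component (sublevel a) x y"
  shows "\<exists>z. norm z = 1 \<and> g z = 0 \<and> a \<le> f z \<and> f z < b"
proof -
  define T where "T = {t. path_component (sublevel t) x y}"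
  define c where "c = Inf T"
  have bT: "b \<in> T" using b by (simp add: T_def)
  have aT: "a \<le> t" if "t \<in> T" for t
  proof (rule ccontr)
    assume "\<not> a \<le> t"
    then have "sublevel t \<subseteq> sublevel a" by auto
    then show False using that a path_component_of_subset unfolding T_def by blast
  qed
  then have bdd: "bdd_below T" by (rule bdd_belowI)
  have ac: "a \<le> c" unfolding c_def using bT aT by (intro cInf_greatest) auto
  have cb: "c < b"
  proof -
    obtain \<gamma> where \<gamma>: "path \<gamma>" "path_image \<gamma> \<subseteq> sublevel b" "pathstart \<gamma> = x" "pathfinish \<gamma> = y"
      using b unfolding path_component_def by blast
    have "compact (path_image \<gamma>)" "path_image \<gamma> \<noteq> {}" using \<gamma>(1) by (auto simp: compact_path_image)
    moreover have "continuous_on (path_image \<gamma>) f"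
      using f_continuous \<gamma>(2) by (rule continuous_on_subset[OF _ subset_trans]) auto
    ultimately obtain w where w: "w \<in> path_image \<gamma>" "\<And>z. z \<in> path_image \<gamma> \<Longrightarrow> f z \<le> f w"
      using continuous_attains_sup by metis
    have fw: "f w < b" using w(1) \<gamma>(2) by auto
    have "path_image \<gamma> \<subseteq> sublevel ((f w + b) / 2)"
    proof
      fix z assume z: "z \<in> path_image \<gamma>"
      then show "z \<in> sublevel ((f w + b) / 2)" using w(2)[OF z] fw \<gamma>(2) by auto
    qed
    then have "(f w + b) / 2 \<in> T" using \<gamma> unfolding T_def path_component_def by blast
    then have "c \<le> (f w + b) / 2" unfolding c_def using bdd by (rule cInf_lower)
    then show ?thesis using fw by simp
  qed
  have "\<exists>z. norm z = 1 \<and> g z = 0 \<and> f z = c"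
  proof (rule ccontr)
    assume none: "\<not> ?thesis"
    have S: "compact (sphere (0::'a) 1)" "sphere (0::'a) 1 \<subseteq> - {0}" "x \<in> sphere 0 1" using x by auto
    have "continuous_on (sphere 0 1) (\<lambda>z. max \<bar>f z - c\<bar> (norm (g z)))"
      using continuous_on_subset[OF cont S(2)] continuous_on_subset[OF f_continuous S(2)]
      by (intro continuous_intros)
    then obtain w where w: "w \<in> sphere 0 1"
      "\<And>z. z \<in> sphere 0 1 \<Longrightarrow> max \<bar>f w - c\<bar> (norm (g w)) \<le> max \<bar>f z - c\<bar> (norm (g z))"
      using continuous_attains_inf[OF S(1)] S(3) by blast
    \<comment> \<open>on the sphere, points with value closer than \<open>\<mu>\<close> to \<open>c\<close> have
      a gradient of norm at least \<open>\<mu>\<close>\<close>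
    define \<mu> where "\<mu> = max \<bar>f w - c\<bar> (norm (g w))"
    have \<mu>: "\<mu> > 0" using none w(1) unfolding \<mu>_def by (auto simp: less_max_iff_disj)
    obtain t where t: "t > 0"
      "\<And>x. norm x = 1 \<Longrightarrow> norm (g x) \<ge> \<mu> \<Longrightarrow> f (x - t *\<^sub>R g x) \<le> f x - t * \<mu>\<^sup>2 / 2"
      "\<And>x. norm x = 1 \<Longrightarrow> f (x - t *\<^sub>R g x) \<le> f x + \<mu> / 2"
      using gradient_step_decreases[OF \<mu>] by blast
    define \<kappa> where "\<kappa> = min (\<mu> / 4) (t * \<mu>\<^sup>2 / 4)"
    have \<kappa>: "\<kappa> > 0" "\<kappa> \<le> \<mu> / 4" "\<kappa> \<le> t * \<mu>\<^sup>2 / 4" using t(1) \<mu> by (auto simp: \<kappa>_def)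
    have "\<exists>t\<in>T. t < c + \<kappa>" using bT \<kappa>(1) unfolding c_def by (intro cInf_lessD) auto
    then obtain t' where t': "path_component (sublevel t') x y" "t' < c + \<kappa>" by (auto simp: T_def)
    have "sublevel t' \<subseteq> sublevel (c + \<kappa>)" using t'(2) by auto
    then have "path_component (sublevel (c + \<kappa>)) x y"
      using t'(1) by (rule path_component_of_subset)
    then obtain \<gamma> where \<gamma>: "path \<gamma>" "path_image \<gamma> \<subseteq> sublevel (c + \<kappa>)" "pathstart \<gamma> = x" "pathfinish \<gamma> = y"
      unfolding path_component_def by blast
    define \<psi> where "\<psi> z = sgn z - t *\<^sub>R g (sgn z)" for z
    have \<psi>: "\<psi> z \<in> sublevel (c - \<kappa> / 2)" if z: "z \<in> path_image \<gamma>" for z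
    proof -
      have z0: "z \<noteq> 0" and fz: "f z < c + \<kappa>" using z \<gamma>(2) by auto
      then have u: "norm (sgn z) = 1" and fu: "f (sgn z) < c + \<kappa>" by (auto simp: norm_sgn f_sgn)
      have "\<psi> z \<noteq> 0" using norm_step_ge_1[OF u, of t] by (auto simp: \<psi>_def)
      moreover have "f (\<psi> z) < c - \<kappa> / 2"
      proof (cases "\<bar>f (sgn z) - c\<bar> < \<mu>")
        case True
        then have "norm (g (sgn z)) \<ge> \<mu>" using w(2)[of "sgn z"] u by (simp add: \<mu>_def max_def split: if_splits)
        then have "f (\<psi> z) \<le> f (sgn z) - t * \<mu>\<^sup>2 / 2" unfolding \<psi>_def by (rule t(2)[OF u])
        then show ?thesis using fu \<kappa> by linarith
      next
        case False
        then have "f (sgn z) \<le> c - \<mu>" using fu \<kappa> \<mu> by linarith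
        moreover have "f (\<psi> z) \<le> f (sgn z) + \<mu> / 2" unfolding \<psi>_def by (rule t(3)[OF u])
        ultimately show ?thesis using \<kappa> \<mu> by linarith
      qed
      ultimately show ?thesis by simp
    qed
    have "continuous_on (- {0}) \<psi>" unfolding \<psi>_def
      by (intro continuous_intros continuous_on_compose2[OF cont]) (auto simp: sgn_zero_iff)
    then have "continuous_on (path_image \<gamma>) \<psi>"
      by (rule continuous_on_subset) (use \<gamma>(2) in auto)
    then have "path (\<psi> \<circ> \<gamma>)" using \<gamma>(1) by (rule path_continuous_image[rotated])
    moreover have "\<psi> x = x" "\<psi> y = y" using x y by (auto simp: \<psi>_def sgn_div_norm)
    then have "pathstart (\<psi> \<circ> \<gamma>) = x" "pathfinish (\<psi> \<circ> \<gamma>) = y"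
      by (simp_all only: pathstart_compose pathfinish_compose \<gamma>(3,4))
    moreover have "path_image (\<psi> \<circ> \<gamma>) \<subseteq> sublevel (c - \<kappa> / 2)"
      unfolding path_image_compose using \<psi> by (rule image_subsetI)
    ultimately have "c - \<kappa> / 2 \<in> T" unfolding T_def path_component_def by blast
    then have "c \<le> c - \<kappa> / 2" unfolding c_def using bdd by (rule cInf_lower)
    then show False using \<kappa>(1) by simp
  qed
  then show ?thesis using ac cb by blast
qed

text \<open>
  A path from \<open>x\<close> to \<open>y\<close>, pushed to the sphere, crosses the compact set of unit vectors at a small
  distance \<open>r\<close> from \<open>x\<close>. As there are finitely many minima, this set can be chosen without any of them,
  so \<open>f\<close> is bounded away from \<open>m\<close> on it.
\<close>

lemma strict_minima_separated:
  assumes lower: "\<And>z. norm z = 1 \<Longrightarrow> m \<le> f z" and fin: "finite {z. norm z = 1 \<and> f z = m}"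
    and x: "norm x = 1" "f x = m" and y: "norm y = 1" "f y = m" and xy: "x \<noteq> y"
  obtains a where "a > m" "\<not> path_component (sublevel a) x y"
proof -
  let ?M = "{z. norm z = 1 \<and> f z = m}"
  define r where "r = Min (dist x ` (?M - {x})) / 2"
  have yM: "y \<in> ?M - {x}" using y xy by auto
  have r2: "2 * r \<le> dist x z" if "z \<in> ?M - {x}" for z
    using fin that unfolding r_def by (simp add: Min_le)
  have "Min (dist x ` (?M - {x})) \<in> dist x ` (?M - {x})" using fin yM by (intro Min_in) auto
  then have r0: "r > 0" unfolding r_def by auto
  define \<Sigma> where "\<Sigma> = sphere 0 1 \<inter> sphere x r"
  have \<Sigma>: "compact \<Sigma>" by (simp add: \<Sigma>_def compact_Int)
  have \<Sigma>m: "f z > m" if "z \<in> \<Sigma>" for z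
  proof -
    have "f z \<noteq> m"
    proof
      assume "f z = m"
      then have "z \<in> ?M - {x}" using that r0 by (auto simp: \<Sigma>_def)
      from r2[OF this] show False using that r0 by (simp add: \<Sigma>_def)
    qed
    then show ?thesis using lower[of z] that by (simp add: \<Sigma>_def)
  qed
  \<comment> \<open>\<open>\<Sigma>\<close> may be empty (in dimension one); any level above \<open>m\<close>
    will do\<close>
  obtain a where a: "a > m" "\<And>z. z \<in> \<Sigma> \<Longrightarrow> a \<le> f z"
  proof (cases "\<Sigma> = {}")
    case True
    then show ?thesis using that[of "m + 1"] by auto
  next
    case False
    have "continuous_on \<Sigma> f"
      using f_continuous by (rule continuous_on_subset) (auto simp: \<Sigma>_def)
    then show ?thesis using continuous_attains_inf[OF \<Sigma> False] that \<Sigma>m by metis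
  qed
  have "\<not> path_component (sublevel a) x y"
  proof
    assume "path_component (sublevel a) x y"
    then obtain \<gamma> where \<gamma>: "path \<gamma>" "path_image \<gamma> \<subseteq> sublevel a" "pathstart \<gamma> = x" "pathfinish \<gamma> = y"
      unfolding path_component_def by blast
    have \<gamma>a: "\<gamma> s \<noteq> 0" "f (\<gamma> s) < a" if "s \<in> {0..1}" for s
    proof -
      have "\<gamma> s \<in> path_image \<gamma>" using that unfolding path_image_def by (rule imageI)
      then show "\<gamma> s \<noteq> 0" "f (\<gamma> s) < a" using \<gamma>(2) by auto
    qed
    have "continuous_on {0..1} (\<lambda>s. dist x (sgn (\<gamma> s)))"
      using \<gamma>(1) \<gamma>a by (intro continuous_intros) (auto simp: path_def)
    moreover have "dist x (sgn (\<gamma> 0)) \<le> r" "r \<le> dist x (sgn (\<gamma> 1))"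
      using \<gamma>(3,4) x y r0 r2[OF yM] by (auto simp: pathstart_def pathfinish_def sgn_div_norm)
    ultimately obtain s where s: "0 \<le> s" "s \<le> 1" "dist x (sgn (\<gamma> s)) = r"
      using IVT'[of "\<lambda>s. dist x (sgn (\<gamma> s))" 0 r 1] by auto
    then have "sgn (\<gamma> s) \<in> \<Sigma>" using \<gamma>a[of s] by (simp add: \<Sigma>_def norm_sgn)
    then show False using a(2) \<gamma>a[of s] s by (fastforce simp: f_sgn)
  qed
  with a(1) show ?thesis by (rule that)
qed

lemma global_minimum_critical:
  assumes lower: "\<And>z. norm z = 1 \<Longrightarrow> m \<le> f z" and x: "norm x = 1" "f x = m"
  shows "g x = 0"
proof -
  have x0: "x \<noteq> 0" using x by auto
  have "m \<le> f y" if "y \<noteq> 0" for y using lower[of "sgn y"] that by (simp add: norm_sgn f_sgn)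
  then have "(\<lambda>h. g x \<bullet> h) = (\<lambda>h. 0)"
    using x0 x(2) by (intro differential_zero_maxmin[OF _ _ deriv[OF x0], of "- {0}"]) auto
  from fun_cong[OF this, of "g x"] show ?thesis by simp
qed

end

text \<open>
  Three vectors of the standard basis and the normalized sum of two of them: each has nonnegative inner
  products with these basis vectors and a positive one with some of them, so none is the negative of
  another.
\<close>

lemma four_nonparallel_unit_vectors:
  assumes "DIM('a::euclidean_space) \<ge> 3"
  obtains C :: "'a::euclidean_space set" where "card C = 4" "C \<subseteq> sphere 0 1" "\<forall>x\<in>C. \<forall>y\<in>C. x \<noteq> - y"
proof -
  obtain B where B: "B \<subseteq> (Basis :: 'a set)" "card B = 3" "finite B"
    using assms by (metis obtain_subset_with_card_n)
  then obtain i j k where ijk: "B = {i, j, k}" "i \<noteq> j" "i \<noteq> k" "j \<noteq> k" by (auto simp: card_3_iff)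
  then have bas: "i \<in> Basis" "j \<in> Basis" "k \<in> Basis" using B(1) by auto
  define d where "d = sgn (i + j)"
  have ij: "i \<bullet> j = 0" "i \<bullet> i = 1" "j \<bullet> j = 1" "i \<bullet> k = 0" "j \<bullet> k = 0" "k \<bullet> k = 1" "j \<bullet> i = 0" "k \<bullet> i = 0" "k \<bullet> j = 0"
    using bas ijk by (auto simp: inner_Basis)
  have "(i + j) \<bullet> i = 1" using ij by (simp add: inner_add_left)
  then have ne: "i + j \<noteq> 0" by auto
  have di: "d \<bullet> i > 0" "d \<bullet> j > 0" "d \<bullet> k = 0"
    using ij ne by (auto simp: d_def sgn_div_norm inner_add_left)
  have nd: "norm d = 1" using ne by (simp add: d_def norm_sgn)
  let ?C = "{i, j, k, d}"
  have dne: "i \<noteq> d" "j \<noteq> d" "k \<noteq> d"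
    using di ij by force+
  then have "card ?C = 4" using ijk dne by simp
  moreover have "?C \<subseteq> sphere 0 1" using bas nd by auto
  moreover have "\<forall>x\<in>?C. \<forall>y\<in>?C. x \<noteq> - y"
  proof (intro ballI notI)
    fix x y assume that: "x \<in> ?C" "y \<in> ?C" and eq: "x = - y"
    have nn: "u \<bullet> w \<ge> 0" if "u \<in> ?C" "w \<in> {i, j, k}" for u w using that ij di by auto
    have pos: "\<exists>w\<in>{i, j, k}. u \<bullet> w > 0" if "u \<in> ?C" for u using that ij di by auto
    from pos[OF that(2)] obtain w where w: "w \<in> {i, j, k}" "y \<bullet> w > 0" by blast
    then show False using nn[OF that(1) w(1)] eq by simp
  qed
  ultimately show ?thesis by (rule that)
qed

context homogeneous_C1
begin

text \<open>
  The combinatorial core. Minima are critical, so the only difficult case is that of three minima \<open>u\<close>,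
  \<open>v\<close>, \<open>w\<close> without an antipodal pair; they are linearly dependent because \<open>0\<close> is in their convex hull.
  The broken line from \<open>u\<close> to \<open>v\<close> through a vector orthogonal to all three misses the rays through the
  maxima \<open>- u\<close>, \<open>- v\<close>, \<open>- w\<close>, so the mountain pass between \<open>u\<close> and \<open>v\<close> lies strictly between the minimum
  \<open>m\<close> and the maximum \<open>V - m\<close>.
\<close>

lemma four_critical_lines:
  assumes dim: "DIM('a) \<ge> 3"
    and anti: "\<And>x. x \<noteq> 0 \<Longrightarrow> f (- x) = V - f x"
    and lower: "\<And>z. norm z = 1 \<Longrightarrow> m \<le> f z"
    and hull: "0 \<in> convex hull {z. norm z = 1 \<and> f z = m}"
  obtains C where "card C = 4" "\<forall>x\<in>C. norm x = 1 \<and> g x = 0" "\<forall>x\<in>C. \<forall>y\<in>C. x \<noteq> - y"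
proof -
  define M where "M = {z. norm z = 1 \<and> f z = m}"
  have hullM: "0 \<in> convex hull M" using hull by (simp add: M_def)
  have crit: "g z = 0" if "z \<in> M" for z
    using global_minimum_critical[OF lower] that by (simp add: M_def)
  show ?thesis
  proof (cases "\<exists>z\<in>M. - z \<in> M")
    case True
    then obtain z where z: "z \<in> M" "- z \<in> M" by blast
    have nz: "norm z = 1" "f z = m" "f (- z) = m" using z by (simp_all add: M_def)
    then have "z \<noteq> 0" by force
    then have V: "V = 2 * m" using anti[of z] nz by simp
    \<comment> \<open>antipodal minima have the same value as the maximum, so \<open>f\<close> is constant\<close>
    have "x \<in> M" if "norm x = 1" for x
    proof -
      have "x \<noteq> 0" using that by auto
      then have "f x \<le> m" using lower[of "- x"] that anti[of x] V by simp
      then show ?thesis using lower[OF that] that by (simp add: M_def)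
    qed
    then have all: "norm x = 1 \<and> g x = 0" if "norm x = 1" for x using crit that by blast
    obtain C :: "'a set" where C: "card C = 4" "C \<subseteq> sphere 0 1"
      "\<forall>x\<in>C. \<forall>y\<in>C. x \<noteq> - y"
      by (rule four_nonparallel_unit_vectors[OF dim])
    show ?thesis
    proof (rule that[OF C(1) _ C(3)])
      show "\<forall>x\<in>C. norm x = 1 \<and> g x = 0" using C(2) by (intro ballI all) auto
    qed
  next
    case False
    then have no_anti: "x \<noteq> - y" if "x \<in> M" "y \<in> M" for x y using that by metis
    show ?thesis
    proof (cases "finite M \<and> card M \<le> 3")
      case False
      then obtain C where C: "C \<subseteq> M" "card C = 4"
      proof (cases "finite M")
        case True
        then have "4 \<le> card M" using False by simp
        then show ?thesis using that by (metis obtain_subset_with_card_n)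
      next
        case inf: False
        then show ?thesis using that infinite_arbitrarily_large[of M 4] by blast
      qed
      show ?thesis
      proof (rule that[OF C(2)])
        show "\<forall>x\<in>C. norm x = 1 \<and> g x = 0"
          using C(1) crit by (auto simp: M_def)
        show "\<forall>x\<in>C. \<forall>y\<in>C. x \<noteq> - y"
          using no_anti C(1) by (meson subsetD)
      qed
    next
      case True
      then have fin: "finite M" by simp
      have M1: "norm z = 1" if "z \<in> M" for z using that by (simp add: M_def)
      have "card M = 3"
      proof (rule ccontr)
        assume "card M \<noteq> 3"
        then have "card M = 0 \<or> card M = 1 \<or> card M = 2" using True by linarith
        then consider "M = {}" | u where "M = {u}" | u w where "M = {u, w}" "u \<noteq> w"
          using fin by (metis card_0_eq card_1_singletonE card_2_iff)
        then show False
        proof cases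
          case 1
          then show ?thesis using hullM by simp
        next
          case (2 u)
          then show ?thesis using hullM M1[of u] by simp
        next
          case (3 u w)
          then obtain a b where ab: "0 \<le> a" "0 \<le> b" "a + b = 1" "0 = a *\<^sub>R u + b *\<^sub>R w"
            using hullM by (auto simp: convex_hull_2)
          then have eq: "a *\<^sub>R u = - (b *\<^sub>R w)" by (metis add_eq_0_iff2)
          then have "norm (a *\<^sub>R u) = norm (b *\<^sub>R w)" by simp
          then have "a = b" using ab M1[of u] M1[of w] 3 by simp
          then have "a \<noteq> 0" using ab by auto
          then have "u = - w" using eq \<open>a = b\<close> by (metis scaleR_cancel_left scaleR_minus_right)
          then show ?thesis using no_anti[of u w] 3 by simp
        qed
      qed
      then obtain u v w where M3: "M = {u, v, w}" and ne: "u \<noteq> v" "u \<noteq> w" "v \<noteq> w"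
        by (auto simp: card_3_iff)
      have "dependent M"
      proof -
        obtain k where k: "\<forall>x\<in>M. 0 \<le> k x" "sum k M = 1" "(\<Sum>x\<in>M. k x *\<^sub>R x) = 0"
          using hullM unfolding convex_hull_finite[OF fin] by auto
        have "\<exists>x\<in>M. k x \<noteq> 0" using k(2) by (metis sum.neutral zero_neq_one)
        then show ?thesis using k(3) fin by (auto simp: dependent_finite)
      qed
      then have "dim M < card M"
        using card_le_dim_spanning[OF subset_refl span_superset fin] by (meson not_less)
      then have "dim M < DIM('a)" using \<open>card M = 3\<close> dim by simp
      then obtain e where e: "e \<noteq> 0" "\<And>y. y \<in> span M \<Longrightarrow> orthogonal e y"
        using orthogonal_to_subspace_exists by metis
      have eM: "e \<bullet> y = 0" if "y \<in> M" for y
        using e(2)[OF span_base[OF that]] by (simp add: orthogonal_def)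
      have ee: "e \<bullet> e > 0" using e(1) by simp
      have mV: "m < V - m"
      proof -
        have uM: "u \<in> M" using M3 by simp
        have "u \<noteq> 0" using M1[OF uM] by auto
        then have "f (- u) = V - m" using anti[of u] uM by (simp add: M_def)
        moreover have "- u \<notin> M" using no_anti[of "- u" u] uM by auto
        then have "f (- u) \<noteq> m" using M1[OF uM] by (simp add: M_def)
        ultimately show ?thesis using lower[of "- u"] M1[OF uM] by simp
      qed
      \<comment> \<open>a point of value \<open>V - m\<close> is opposite to a minimum, hence orthogonal to
        \<open>e\<close>; on the segment only \<open>x\<close> is orthogonal to \<open>e\<close>\<close>
      have seg: "closed_segment x e \<subseteq> sublevel (V - m)" if xM: "x \<in> M" for x
      proof
        fix z assume "z \<in> closed_segment x e"
        then obtain t where t: "0 \<le> t" "t \<le> 1" and z: "z = (1 - t) *\<^sub>R x + t *\<^sub>R e"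
          by (auto simp: closed_segment_def)
        show "z \<in> sublevel (V - m)"
        proof (cases "t = 0")
          case True
          then show ?thesis using z xM M1[OF xM] mV by (auto simp: M_def)
        next
          case False
          have "e \<bullet> z = t * (e \<bullet> e)" using eM[OF xM] by (simp add: z inner_add_right)
          then have ez: "e \<bullet> z > 0" using False t ee by simp
          then have z0: "z \<noteq> 0" by auto
          have "sgn (- z) \<notin> M" using eM[of "sgn (- z)"] ez z0 by (auto simp: sgn_div_norm)
          then have "f (sgn (- z)) \<noteq> m" using z0 by (auto simp: M_def norm_sgn)
          moreover have "m \<le> f (sgn (- z))" using z0 by (intro lower) (simp add: norm_sgn)
          moreover have "f (sgn (- z)) = V - f z" using z0 by (simp add: f_sgn anti del: sgn_minus)
          ultimately show ?thesis using z0 by simp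
        qed
      qed
      have pc: "path_component (sublevel (V - m)) x e" if "x \<in> M" for x
      proof -
        have "path_component (closed_segment x e) x e"
          using path_connected_segment(1)[of x e] unfolding path_connected_component by simp
        then show ?thesis using seg[OF that] by (rule path_component_of_subset[rotated])
      qed
      have uM: "u \<in> M" and vM: "v \<in> M" using M3 by auto
      have pcuv: "path_component (sublevel (V - m)) u v"
        using pc[OF uM] path_component_sym[OF pc[OF vM]] by (rule path_component_trans)
      obtain a where a: "a > m" "\<not> path_component (sublevel a) u v"
        using strict_minima_separated[OF lower, of u v] fin uM vM ne(1) unfolding M_def by auto
      obtain x where x: "norm x = 1" "g x = 0" "a \<le> f x" "f x < V - m"
        using mountain_pass[OF _ _ _ _ pcuv a(2)] crit M1 uM vM by blast
      have xM: "x \<noteq> y" "x \<noteq> - y" if "y \<in> M" for y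
      proof -
        have "y \<noteq> 0" using M1[OF that] by auto
        then have "f y = m" "f (- y) = V - m" using that anti[of y] by (auto simp: M_def)
        then show "x \<noteq> y" "x \<noteq> - y" using x a(1) by auto
      qed
      show ?thesis
      proof (rule that[of "insert x M"])
        show "card (insert x M) = 4" using \<open>card M = 3\<close> fin xM(1) by (subst card_insert_disjoint) auto
        show "\<forall>y\<in>insert x M. norm y = 1 \<and> g y = 0" using x crit M1 by auto
        have x0: "x \<noteq> - x"
        proof
          assume "x = - x"
          then have "2 *\<^sub>R x = 0" by (metis add.right_inverse scaleR_2)
          then show False using x(1) by simp
        qed
        have x0': "y \<noteq> - x" if "y \<in> M" for y using xM(2)[OF that] by auto
        show "\<forall>y\<in>insert x M. \<forall>z\<in>insert x M. y \<noteq> - z"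
        proof (intro ballI)
          fix y z assume "y \<in> insert x M" "z \<in> insert x M"
          then consider "y = x" "z = x" | "y = x" "z \<in> M" | "y \<in> M" "z = x" | "y \<in> M" "z \<in> M"
            by auto
          then show "y \<noteq> - z"
          proof cases
            case 1
            then show ?thesis using x0 by simp
          next
            case 2
            then show ?thesis using xM(2) by simp
          next
            case 3
            then show ?thesis using x0' by simp
          next
            case 4
            then show ?thesis by (rule no_anti)
          qed
        qed
      qed
    qed
  qed
qed

end

section \<open>Symmetry and continuity of the cut volume\<close>

lemma cut_fraction_eq:
  assumes "compact K"
  shows "cut_fraction K p v = cut_volume K p v / measure lborel K"
proof -
  have [measurable]: "K \<in> sets borel" using assms by (simp add: borel_compact)
  have "halfspace_at p v \<inter> K = {x \<in> K. 0 \<le> v \<bullet> (x - p)}" by (auto simp: halfspace_at_def)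
  moreover have "{x \<in> K. 0 \<le> v \<bullet> (x - p)} \<in> sets lborel" by measurable
  moreover have "K \<in> sets lborel" by simp
  ultimately show ?thesis by (simp only: cut_fraction_def cut_volume_def measure_completion)
qed

lemma cut_volume_scale:
  assumes "c > 0"
  shows "cut_volume K p (c *\<^sub>R z) = cut_volume K p z"
  using assms by (simp add: cut_volume_def zero_le_mult_iff)

lemma AE_not_hyperplane:
  fixes z p :: "'a::euclidean_space"
  assumes "z \<noteq> 0"
  shows "AE x in lborel. z \<bullet> (x - p) \<noteq> 0"
proof -
  have "negligible {x. z \<bullet> x = z \<bullet> p}" using assms by (simp add: negligible_hyperplane)
  moreover have "{x. z \<bullet> x = z \<bullet> p} \<in> sets lborel" by simp
  ultimately have "{x. z \<bullet> x = z \<bullet> p} \<in> null_sets lborel"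
    by (simp add: negligible_iff_null_sets null_sets_completion_iff)
  from AE_not_in[OF this] show ?thesis by eventually_elim (simp add: inner_diff_right)
qed

lemma fmeasurable_cut:
  assumes "compact K"
  shows "{x \<in> K. 0 \<le> z \<bullet> (x - p)} \<in> fmeasurable lborel"
proof (rule fmeasurableI)
  have [measurable]: "K \<in> sets borel" using assms by (simp add: borel_compact)
  show "{x \<in> K. 0 \<le> z \<bullet> (x - p)} \<in> sets lborel" by measurable
  have "bounded {x \<in> K. 0 \<le> z \<bullet> (x - p)}"
    by (rule bounded_subset[OF compact_imp_bounded[OF assms]]) auto
  then show "emeasure lborel {x \<in> K. 0 \<le> z \<bullet> (x - p)} < \<infinity>" by (rule emeasure_bounded_finite)
qed

lemma cut_volume_uminus:
  assumes K: "compact K" and z: "z \<noteq> 0"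
  shows "cut_volume K p (- z) = measure lborel K - cut_volume K p z"
proof -
  let ?A = "{x \<in> K. 0 \<le> z \<bullet> (x - p)}" and ?B = "{x \<in> K. 0 \<le> (- z) \<bullet> (x - p)}"
  have "K = ?A \<union> ?B" by auto
  moreover have "measure lborel (?A \<union> ?B) = measure lborel ?A + measure lborel ?B"
  proof (rule measure_Un_AE)
    show "AE x in lborel. x \<notin> ?A \<or> x \<notin> ?B"
      using AE_not_hyperplane[OF z, of p] by eventually_elim auto
  qed (rule fmeasurable_cut[OF K])+
  ultimately show ?thesis unfolding cut_volume_def by simp
qed

text \<open>
  The indicator functions of the cuts converge except on the limiting hyperplane, which is a null set.
\<close>

lemma cut_volume_tendsto:
  assumes K: "compact K" and P: "P \<longlonglongrightarrow> p" and Z: "Z \<longlonglongrightarrow> z" and z: "z \<noteq> 0"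
  shows "(\<lambda>n. cut_volume K (P n) (Z n)) \<longlonglongrightarrow> cut_volume K p z"
proof -
  have Kb[measurable]: "K \<in> sets borel" using K by (simp add: borel_compact)
  let ?I = "\<lambda>p z. indicator {x \<in> K. 0 \<le> z \<bullet> (x - p)} :: _ \<Rightarrow> real"
  have eq: "cut_volume K p z = (\<integral>x. ?I p z x \<partial>lborel)" for p z
    unfolding cut_volume_def by simp
  have "(\<lambda>n. \<integral>x. ?I (P n) (Z n) x \<partial>lborel) \<longlonglongrightarrow> (\<integral>x. ?I p z x \<partial>lborel)"
  proof (rule integral_dominated_convergence[where w = "indicator K"])
    show "integrable lborel (indicator K :: _ \<Rightarrow> real)"
      using Kb emeasure_bounded_finite[OF compact_imp_bounded[OF K]]
      by (intro integrable_real_indicator) auto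
    show "AE x in lborel. (\<lambda>n. ?I (P n) (Z n) x) \<longlonglongrightarrow> ?I p z x"
      using AE_not_hyperplane[OF z, of p]
    proof eventually_elim
      case (elim x)
      have lim: "(\<lambda>n. Z n \<bullet> (x - P n)) \<longlonglongrightarrow> z \<bullet> (x - p)" by (intro tendsto_intros P Z)
      have "\<forall>\<^sub>F n in sequentially. (0 \<le> Z n \<bullet> (x - P n)) = (0 \<le> z \<bullet> (x - p))"
      proof (cases "z \<bullet> (x - p) > 0")
        case True
        from order_tendstoD(1)[OF lim True] show ?thesis by eventually_elim (use True in simp)
      next
        case False
        then have neg: "z \<bullet> (x - p) < 0" using elim by linarith
        from order_tendstoD(2)[OF lim neg] show ?thesis by eventually_elim (use neg in simp)
      qed
      then show ?case
        by (intro tendsto_eventually) (auto elim!: eventually_mono simp: indicator_def)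
    qed
    show "AE x in lborel. norm (?I (P n) (Z n) x) \<le> indicator K x" for n
      by (simp add: indicator_def)
  qed measurable
  then show ?thesis by (simp only: eq)
qed

section \<open>The point of maximal depth\<close>

lemma depth_attained:
  fixes K :: "(real^'n) set"
  assumes K: "compact K"
  obtains v where "norm v = 1" "depth p K = cut_volume K p v / measure lborel K"
    "\<And>w. norm w = 1 \<Longrightarrow> cut_volume K p v \<le> cut_volume K p w"
proof -
  have "continuous_on (sphere 0 1) (cut_volume K p)"
    unfolding continuous_on_sequentially comp_def
    using cut_volume_tendsto[OF K tendsto_const[of p]] by fastforce
  moreover have ne: "sphere (0::real^'n) 1 \<noteq> {}" by simp
  ultimately obtain v where v: "v \<in> sphere 0 1"
    "\<And>w. w \<in> sphere 0 1 \<Longrightarrow> cut_volume K p v \<le> cut_volume K p w"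
    using continuous_attains_inf[OF compact_sphere] by blast
  have frac: "cut_fraction K p v \<le> cut_fraction K p w" if "w \<in> sphere 0 1" for w
    unfolding cut_fraction_eq[OF K] using v(2)[OF that] by (intro divide_right_mono) auto
  have "depth p K = cut_fraction K p v"
    unfolding depth_def
  proof (rule antisym)
    show "(INF v\<in>sphere 0 1. cut_fraction K p v) \<le> cut_fraction K p v"
      using v(1) frac by (intro cINF_lower bdd_belowI2[where m = "cut_fraction K p v"]) auto
    show "cut_fraction K p v \<le> (INF v\<in>sphere 0 1. cut_fraction K p v)"
      using ne frac by (intro cINF_greatest) auto
  qed
  then show ?thesis using that[of v] v by (simp add: cut_fraction_eq[OF K])
qed

text \<open>
  The point \<open>p\<close> is interior, so the slab that is gained contains a ball inside \<open>K\<close>.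
\<close>

lemma cut_volume_strict_mono:
  fixes K :: "(real^'n) set"
  assumes K: "compact K" and p: "p \<in> interior K" and z: "norm z = 1" and d: "d \<bullet> z > 0"
  shows "cut_volume K p z < cut_volume K (p - d) z"
proof -
  have [measurable]: "K \<in> sets borel" using K by (simp add: borel_compact)
  define U where "U = interior K \<inter> {x. z \<bullet> x < z \<bullet> p} \<inter> {x. z \<bullet> x > z \<bullet> (p - d)}"
  have openU: "open U" unfolding U_def by (intro open_Int open_halfspace_lt open_halfspace_gt open_interior)
  obtain e where e: "e > 0" "ball p e \<subseteq> interior K"
    using p open_contains_ball open_interior by blast
  define s where "s = min (e / 2) ((d \<bullet> z) / 2)"
  have s: "s > 0" "s < e" "s < d \<bullet> z" using e d by (auto simp: s_def)
  have zz: "z \<bullet> z = 1" using z by (simp add: dot_square_norm)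
  have "p - s *\<^sub>R z \<in> ball p e" using s z by (simp add: dist_norm)
  then have "p - s *\<^sub>R z \<in> U"
    using e s zz by (auto simp: U_def inner_diff_right inner_commute)
  then obtain r where r: "r > 0" "ball (p - s *\<^sub>R z) r \<subseteq> U"
    using openU open_contains_ball by blast
  let ?A = "{x \<in> K. 0 \<le> z \<bullet> (x - p)}" and ?B = "ball (p - s *\<^sub>R z) r"
  have sub: "?A \<union> ?B \<subseteq> {x \<in> K. 0 \<le> z \<bullet> (x - (p - d))}"
  proof -
    have "?B \<subseteq> {x \<in> K. 0 \<le> z \<bullet> (x - (p - d))}"
      using r(2) interior_subset[of K] by (auto simp: U_def inner_diff_right subset_iff)
    moreover have "?A \<subseteq> {x \<in> K. 0 \<le> z \<bullet> (x - (p - d))}"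
      using d by (auto simp: inner_diff_right inner_commute)
    ultimately show ?thesis by blast
  qed
  have B: "?B \<in> fmeasurable lborel"
    by (intro fmeasurableI emeasure_bounded_finite) auto
  have "measure lborel ?A < measure lborel ?A + measure lborel ?B"
    using content_ball_pos[OF r(1), of "p - s *\<^sub>R z"] by simp
  also have "\<dots> = measure lborel (?A \<union> ?B)"
  proof (rule measure_Un_AE[symmetric])
    have "?A \<inter> ?B = {}" using r(2) by (auto simp: U_def inner_diff_right subset_iff)
    then show "AE x in lborel. x \<notin> ?A \<or> x \<notin> ?B" by blast
  qed (use B fmeasurable_cut[OF K] in auto)
  also have "\<dots> \<le> measure lborel {x \<in> K. 0 \<le> z \<bullet> (x - (p - d))}"
    using sub B fmeasurable_cut[OF K, of z p]
    by (intro measure_mono_fmeasurable fmeasurable_cut[OF K] fmeasurable.Un) auto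
  finally show ?thesis by (simp add: cut_volume_def)
qed

text \<open>
  If \<open>0\<close> were outside the hull, some vector \<open>u\<close> would have a positive inner product with all minimal
  directions at \<open>p\<close>. Let the point
  move to \<open>p\<close> along \<open>p - u / (n + 1)\<close>. As \<open>p\<close> has maximal depth, the minimal directions at these points
  give cuts of volume at most \<open>m\<close>; they accumulate at a minimal direction at \<open>p\<close>, so eventually they have
  positive inner product with \<open>u\<close>. Then the corresponding cuts through \<open>p\<close> are strictly smaller than
  \<open>m\<close>, a contradiction.
\<close>

lemma zero_in_hull_of_minimal_directions:
  fixes K :: "(real^'n) set"
  assumes body: "convex_body K" and max: "is_point_of_maximal_depth K p"
  obtains m where "\<And>z. norm z = 1 \<Longrightarrow> m \<le> cut_volume K p z"
    "0 \<in> convex hull {z. norm z = 1 \<and> cut_volume K p z = m}"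
proof -
  have K: "compact K" and p: "p \<in> interior K"
    using body max by (auto simp: convex_body_def is_point_of_maximal_depth_def)
  have T: "measure lborel K > 0"
  proof -
    obtain e where e: "e > 0" "ball p e \<subseteq> K" using p mem_interior by blast
    have "K \<in> fmeasurable lborel"
      using K by (intro fmeasurableI emeasure_bounded_finite) (auto simp: borel_compact compact_imp_bounded)
    then have "measure lborel (ball p e) \<le> measure lborel K"
      using e(2) by (intro measure_mono_fmeasurable) auto
    then show ?thesis using content_ball_pos[OF e(1), of p] by linarith
  qed
  obtain v0 where v0: "norm v0 = 1" "depth p K = cut_volume K p v0 / measure lborel K"
    "\<And>w. norm w = 1 \<Longrightarrow> cut_volume K p v0 \<le> cut_volume K p w"
    using depth_attained[OF K] by blast
  define m where "m = cut_volume K p v0"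
  define M where "M = {z. norm z = 1 \<and> cut_volume K p z = m}"
  have contF: "continuous_on (sphere 0 1) (cut_volume K p)"
    unfolding continuous_on_sequentially comp_def
    using cut_volume_tendsto[OF K tendsto_const[of p]] by fastforce
  have "M = {z \<in> sphere 0 1. cut_volume K p z = m}" by (auto simp: M_def)
  then have "closed M" using continuous_closed_preimage_constant[OF contF closed_sphere] by simp
  moreover have "bounded M" by (rule bounded_subset[OF bounded_sphere[of 0 1]]) (auto simp: M_def)
  ultimately have "compact M" by (simp add: compact_eq_bounded_closed)
  then have closed: "closed (convex hull M)" by (intro compact_imp_closed compact_convex_hull)
  have "0 \<in> convex hull M"
  proof (rule ccontr)
    assume "0 \<notin> convex hull M"
    from separating_hyperplane_closed_0[OF convex_convex_hull closed this]
    obtain u b where ub: "0 < b" "\<And>x. x \<in> convex hull M \<Longrightarrow> u \<bullet> x > b" by blast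
    define P where "P n = p - inverse (real (Suc n)) *\<^sub>R u" for n
    have "P \<longlonglongrightarrow> p - 0 *\<^sub>R u" unfolding P_def by (intro tendsto_intros LIMSEQ_inverse_real_of_nat)
    then have P: "P \<longlonglongrightarrow> p" by simp
    have "\<forall>n. \<exists>v. norm v = 1 \<and> depth (P n) K = cut_volume K (P n) v / measure lborel K"
      using depth_attained[OF K] by metis
    then obtain V where V: "\<And>n. norm (V n) = 1"
      "\<And>n. depth (P n) K = cut_volume K (P n) (V n) / measure lborel K" by metis
    have small: "cut_volume K (P n) (V n) \<le> m" if "P n \<in> interior K" for n
    proof -
      have "depth (P n) K \<le> depth p K" using max that by (auto simp: is_point_of_maximal_depth_def)
      then show ?thesis unfolding V(2) v0(2) m_def using T by (simp add: divide_le_cancel)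
    qed
    have "\<forall>n. V n \<in> sphere 0 1" using V(1) by simp
    then obtain v r where v: "v \<in> sphere 0 1" and r: "strict_mono r" and Vr: "(V \<circ> r) \<longlonglongrightarrow> v"
      using compact_sphere[of "0::real^'n" 1] unfolding compact_def by metis
    have Pr: "(P \<circ> r) \<longlonglongrightarrow> p" using P r by (rule LIMSEQ_subseq_LIMSEQ)
    have int: "\<forall>\<^sub>F n in sequentially. (P \<circ> r) n \<in> interior K"
      using topological_tendstoD[OF Pr open_interior p] .
    have "(\<lambda>n. cut_volume K ((P \<circ> r) n) ((V \<circ> r) n)) \<longlonglongrightarrow> cut_volume K p v"
      using v by (intro cut_volume_tendsto[OF K Pr Vr]) auto
    moreover have "\<forall>\<^sub>F n in sequentially. cut_volume K ((P \<circ> r) n) ((V \<circ> r) n) \<le> m"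
      using int by eventually_elim (auto intro: small)
    ultimately have "cut_volume K p v \<le> m" by (rule tendsto_upperbound) simp
    then have "v \<in> M" using v v0(3)[of v] by (simp add: M_def m_def)
    then have "u \<bullet> v > 0" using ub(2)[OF hull_inc] ub(1) by force
    moreover have "(\<lambda>n. u \<bullet> (V \<circ> r) n) \<longlonglongrightarrow> u \<bullet> v" by (intro tendsto_intros Vr)
    ultimately have "\<forall>\<^sub>F n in sequentially. u \<bullet> (V \<circ> r) n > 0" by (rule order_tendstoD(1)[rotated])
    with int have "\<forall>\<^sub>F n in sequentially. (P \<circ> r) n \<in> interior K \<and> u \<bullet> (V \<circ> r) n > 0"
      by (rule eventually_conj)
    then obtain n where n: "P (r n) \<in> interior K" "u \<bullet> V (r n) > 0"
      using eventually_happens'[OF sequentially_bot] by fastforce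
    have "m \<le> cut_volume K p (V (r n))" using v0(3) V(1) by (simp add: m_def)
    also have "\<dots> < cut_volume K (p - inverse (real (Suc (r n))) *\<^sub>R u) (V (r n))"
      using n(2) by (intro cut_volume_strict_mono[OF K p V(1)]) simp
    also have "\<dots> \<le> m" using small[OF n(1)] by (simp add: P_def)
    finally show False by simp
  qed
  then show ?thesis using that[of m] v0(3) by (simp add: m_def M_def)
qed

section \<open>Barycentric hyperplanes\<close>

lemma body_frame_exists:
  assumes body: "convex_body K" and p: "p \<in> interior K" and v: "norm v = 1"
  obtains a B where "body_frame p v a B K" "lebesgue_of {x. v \<bullet> (x - p) = 0} = completion (frame_lborel a B)"
proof -
  have "is_hyperplane {x. v \<bullet> (x - p) = 0}"
    unfolding is_hyperplane_def using v by (intro exI[of _ v] exI[of _ "v \<bullet> p"]) (auto simp: inner_diff_right)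
  then obtain a B where "orthonormal_frame {x. v \<bullet> (x - p) = 0} a B"
    "lebesgue_of {x. v \<bullet> (x - p) = 0} = completion (frame_lborel a B)"
    by (rule lebesgue_of_frame)
  then show ?thesis using that[of a B] body p v
    by (auto simp: body_frame_def body_frame_axioms_def hyperplane_frame_def convex_body_def)
qed

text \<open>
  The gradient does not depend on the chart, by uniqueness of derivatives. Near \<open>z\<close> the chart centered at
  \<open>sgn z\<close> gives existence and continuity; the chart centered at a unit vector \<open>v\<close> itself identifies the
  gradient at \<open>v\<close> with the moment of the section.
\<close>

lemma cut_volume_C1:
  fixes K :: "(real^'n) set"
  assumes body: "convex_body K" and p: "p \<in> interior K"
  obtains g where "homogeneous_C1 (cut_volume K p) g"
    "\<forall>v. norm v = 1 \<longrightarrow> g v = 0 \<longrightarrow>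
      is_barycenter p {x. v \<bullet> (x - p) = 0} (K \<inter> {x. v \<bullet> (x - p) = 0})"
proof -
  define g where "g z = (SOME G. (cut_volume K p has_derivative (\<lambda>h. G \<bullet> h)) (at z))" for z
  have g_eq: "g z = G" if "(cut_volume K p has_derivative (\<lambda>h. G \<bullet> h)) (at z)" for z G
  proof -
    have "(cut_volume K p has_derivative (\<lambda>h. g z \<bullet> h)) (at z)"
      unfolding g_def by (rule someI) (rule that)
    then have "(\<lambda>h. g z \<bullet> h) = (\<lambda>h. G \<bullet> h)" using that by (rule has_derivative_unique)
    then show ?thesis by (metis vector_eq_rdot inner_commute)
  qed
  have local: "\<exists>a B. body_frame p (sgn z) a B K" and pos: "z \<bullet> sgn z > 0" if "z \<noteq> 0" for z :: "real^'n"
  proof -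
    show "\<exists>a B. body_frame p (sgn z) a B K"
      using body_frame_exists[OF body p, of "sgn z"] that by (metis norm_sgn)
    show "z \<bullet> sgn z > 0" using that by (simp add: sgn_div_norm)
  qed
  have "homogeneous_C1 (cut_volume K p) g"
  proof
    show "cut_volume K p (c *\<^sub>R z) = cut_volume K p z" if "c > 0" for c z
      using that by (rule cut_volume_scale)
    show "(cut_volume K p has_derivative (\<lambda>h. g z \<bullet> h)) (at z)" if z: "z \<noteq> 0" for z
    proof -
      obtain a B where "body_frame p (sgn z) a B K" using local[OF z] by blast
      then interpret body_frame p "sgn z" a B K .
      from cut_volume_has_derivative[OF pos[OF z]] show ?thesis using g_eq by metis
    qed
    show "continuous_on (- {0}) g"
    proof (intro continuous_at_imp_continuous_on ballI)
      fix z :: "real^'n" assume "z \<in> - {0}"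
      then have z: "z \<noteq> 0" by simp
      obtain a B where "body_frame p (sgn z) a B K" using local[OF z] by blast
      then interpret body_frame p "sgn z" a B K .
      let ?H = "{x. x \<bullet> sgn z > 0}"
      have "continuous_on ?H g"
        using moment_continuous g_eq[OF cut_volume_has_derivative]
        by (subst continuous_on_cong[OF refl]) auto
      moreover have "open ?H" by (intro open_Collect_less continuous_intros)
      ultimately show "isCont g z" using pos[OF z] continuous_on_eq_continuous_at by blast
    qed
  qed
  moreover have "is_barycenter p {x. v \<bullet> (x - p) = 0} (K \<inter> {x. v \<bullet> (x - p) = 0})"
    if v: "norm v = 1" "g v = 0" for v
  proof -
    obtain a B where bf: "body_frame p v a B K"
      and leb: "lebesgue_of {x. v \<bullet> (x - p) = 0} = completion (frame_lborel a B)"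
      by (rule body_frame_exists[OF body p v(1)])
    interpret body_frame p v a B K by (rule bf)
    have "moment v = 0" using g_eq[OF cut_volume_has_derivative] vv v(2) by simp
    with leb show ?thesis by (rule barycenter_if_moment_zero)
  qed
  ultimately show ?thesis using that by blast
qed

lemma hyperplane_unit_normal:
  fixes p v w :: "'a::real_inner"
  assumes v: "norm v = 1" and w: "norm w = 1"
    and eq: "{x. v \<bullet> (x - p) = 0} = {x. w \<bullet> (x - p) = 0}"
  shows "v = w \<or> v = - w"
proof -
  define d where "d = v \<bullet> w"
  have n: "v \<bullet> v = 1" "w \<bullet> w = 1" using v w by (auto simp: dot_square_norm)
  have "p + (v - d *\<^sub>R w) \<in> {x. w \<bullet> (x - p) = 0}"
    using n by (simp add: inner_diff_right inner_add_right d_def inner_commute)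
  then have "p + (v - d *\<^sub>R w) \<in> {x. v \<bullet> (x - p) = 0}" by (simp only: eq)
  then have dd: "d * d = 1" using n by (simp add: inner_diff_right inner_add_right d_def)
  have "(v - d *\<^sub>R w) \<bullet> (v - d *\<^sub>R w) = 1 - d * d"
    using n by (simp add: inner_diff_right inner_diff_left d_def inner_commute)
  then have "v = d *\<^sub>R w" using dd by simp
  moreover have "d = 1 \<or> d = - 1" using dd by (simp add: square_eq_1_iff)
  ultimately show ?thesis by auto
qed

theorem theorem10:
  fixes K :: "(real^'n) set" and p0 :: "real^'n"
  assumes "CARD('n) \<ge> 3"
    and "convex_body K"
    and "is_point_of_maximal_depth K p0"
  shows "\<exists>\<H>. card \<H> = 4 \<and>
           (\<forall>h\<in>\<H>. is_hyperplane h \<and> p0 \<in> h \<and> is_barycenter p0 h (K \<inter> h))"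
proof -
  have p: "p0 \<in> interior K" and K: "compact K"
    using assms by (auto simp: is_point_of_maximal_depth_def convex_body_def)
  obtain g where "homogeneous_C1 (cut_volume K p0) g" and
    bary: "\<forall>v. norm v = 1 \<longrightarrow> g v = 0 \<longrightarrow>
      is_barycenter p0 {x. v \<bullet> (x - p0) = 0} (K \<inter> {x. v \<bullet> (x - p0) = 0})"
    by (rule cut_volume_C1[OF assms(2) p])
  then interpret homogeneous_C1 "cut_volume K p0" g by simp
  obtain m where m: "\<And>z. norm z = 1 \<Longrightarrow> m \<le> cut_volume K p0 z"
    "0 \<in> convex hull {z. norm z = 1 \<and> cut_volume K p0 z = m}"
    using zero_in_hull_of_minimal_directions[OF assms(2,3)] by blast
  have dim: "DIM(real^'n) \<ge> 3" using assms(1) by simp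
  obtain C where C: "card C = 4" "\<forall>v\<in>C. norm v = 1 \<and> g v = 0" "\<forall>v\<in>C. \<forall>w\<in>C. v \<noteq> - w"
    by (rule four_critical_lines[OF dim cut_volume_uminus[OF K] m])
  let ?h = "\<lambda>v. {x. v \<bullet> (x - p0) = 0}"
  have "inj_on ?h C"
    using C(2,3) hyperplane_unit_normal[of _ _ p0] by (intro inj_onI) blast
  then have "card (?h ` C) = 4" using C(1) by (simp add: card_image)
  moreover have "is_hyperplane h \<and> p0 \<in> h \<and> is_barycenter p0 h (K \<inter> h)" if h: "h \<in> ?h ` C" for h
  proof -
    obtain v where v: "v \<in> C" "h = ?h v" using h by auto
    have "v \<noteq> 0" using C(2) v(1) by force
    then have "is_hyperplane h" unfolding is_hyperplane_def v(2)
      by (intro exI[of _ v] exI[of _ "v \<bullet> p0"]) (auto simp: inner_diff_right)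
    moreover have "p0 \<in> h" by (simp add: v(2))
    moreover have "is_barycenter p0 h (K \<inter> h)" using bary C(2) v by blast
    ultimately show ?thesis by blast
  qed
  ultimately show ?thesis by blast
qed

end
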